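(* Let $\mathbb{P}$ denote the set of primes and, for integers $n\ge 1$, let $$n!_{S'} = \prod_{p\in\mathbb{P}} p^{\sum_{k\ge 0}\left\lfloor \frac{n-1}{\lceil (p-1)/2\rceil\, p^k}\right\rfloor}.$$ Then, as $n\to\infty$, $$\log (n+1)!_{S'} = \log (2n)! + \beta n + o(n),\qquad \text{where } \beta = \sum_{p \in \mathbb{P}} \frac{\log p}{p-1} \left( \frac{p}{\lceil (p-1)/2 \rceil} - 2\right) = 1.0676431\dots .$$
   Context: $\log$ is the natural logarithm; $\lfloor\cdot\rfloor$ and $\lceil\cdot\rceil$ are the floor and ceiling functions. In the paper, $n!_{S'}$ is the Bhargava factorial over a set $S'=\{2,4,16,22,\dots\}$ associated with OEIS sequence A202367 ($1,6,360,45360,\dots$), and it is taken to be given by the displayed product formula, which is used as its definition here.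
   Formalization: The printed value β = 1.0676431… is wrong in its last digit (β = 1.06764325…); the formal statement proves 1.0676432 ≤ β < 1.0676433 instead, and everything else is as stated. *)

theory Defs
  imports
    "HOL-Analysis.Analysis"
    "HOL-Library.Landau_Symbols"
    "HOL-Computational_Algebra.Primes"
begin

text \<open>
  Only finitely many summands are nonzero when \<open>p\<close> is prime. The conversion \<open>nat\<close> loses nothing
  for \<open>n \<ge> 1\<close>, since the floors are then nonnegative.
\<close>
definition bhargava_exponent :: "nat \<Rightarrow> nat \<Rightarrow> nat" where
  "bhargava_exponent p n =
     (\<Sum>k. nat \<lfloor>(real n - 1) / (real_of_int \<lceil>(real p - 1) / 2\<rceil> * real p ^ k)\<rfloor>)"

text \<open>
  The product over all primes is written as an infinite product over \<open>nat\<close> with factor 1 at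
  non-primes; all but finitely many factors equal 1 (see \<open>bhargava_factorial_finite\<close> below).
\<close>
definition bhargava_factorial :: "nat \<Rightarrow> nat" where
  "bhargava_factorial n = (\<Prod>p. if prime p then p ^ bhargava_exponent p n else 1)"

text \<open>
  The term at 2 vanishes and the term at an odd prime \<open>p\<close> equals \<open>2 * ln p / (p - 1)\<^sup>2\<close>. The value is
  1.06764325..., so the published expansion 1.0676431... is off by one in its last digit.
\<close>
definition bhargava_beta :: real where
  "bhargava_beta =
     (\<Sum>\<^sub>\<infinity>p\<in>{p::nat. prime p}.
        ln (real p) / (real p - 1) * (real p / real_of_int \<lceil>(real p - 1) / 2\<rceil> - 2))"

lemma bhargava_term_eq_0:
  assumes p: "prime p" and big: "2 * n \<le> p \<or> n \<le> k"
  shows "nat \<lfloor>(real n - 1) / (real_of_int \<lceil>(real p - 1) / 2\<rceil> * real p ^ k)\<rfloor> = 0"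
proof -
  define c where "c = real_of_int \<lceil>(real p - 1) / 2\<rceil>"
  have p2: "p \<ge> 2" using p by (rule prime_ge_2_nat)
  have c1: "c \<ge> 1" using p2 unfolding c_def by simp
  have cp: "c \<ge> (real p - 1) / 2" unfolding c_def by linarith
  have pk1: "real p ^ k \<ge> 1" using p2 by simp
  have "real n - 1 < c * real p ^ k"
    using big
  proof
    assume "2 * n \<le> p"
    hence "real n - 1 < c" using cp by (simp add: field_simps)
    also have "c \<le> c * real p ^ k" using c1 pk1 by simp
    finally show ?thesis .
  next
    assume "n \<le> k"
    have "n < 2 ^ n" by (rule less_exp)
    also have "(2::nat) ^ n \<le> p ^ k"
      using \<open>n \<le> k\<close> p2 by (meson order_trans power_increasing power_mono one_le_numeral zero_le)
    finally have "real n < real p ^ k" by (metis of_nat_less_iff of_nat_power)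
    also have "real p ^ k \<le> c * real p ^ k"
      using mult_right_mono[OF c1, of "real p ^ k"] by simp
    finally show ?thesis by simp
  qed
  moreover have "c * real p ^ k > 0" using c1 p2 by simp
  ultimately have "(real n - 1) / (c * real p ^ k) < 1" by (simp add: divide_less_eq)
  thus ?thesis unfolding c_def by linarith
qed

lemma bhargava_exponent_finite:
  assumes "prime p"
  shows "bhargava_exponent p n =
    (\<Sum>k<n. nat \<lfloor>(real n - 1) / (real_of_int \<lceil>(real p - 1) / 2\<rceil> * real p ^ k)\<rfloor>)"
  unfolding bhargava_exponent_def
  by (rule suminf_finite[OF finite_lessThan]) (rule bhargava_term_eq_0[OF assms], simp)

lemma bhargava_factorial_finite:
  "bhargava_factorial n = (\<Prod>p | prime p \<and> p < 2 * n. p ^ bhargava_exponent p n)"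
proof -
  have "bhargava_factorial n =
      (\<Prod>p<2*n. if prime p then p ^ bhargava_exponent p n else 1)"
    unfolding bhargava_factorial_def
  proof (rule has_prod_unique[symmetric], rule has_prod_finite)
    fix p :: nat assume "p \<notin> {..<2 * n}"
    thus "(if prime p then p ^ bhargava_exponent p n else 1) = 1"
      using bhargava_term_eq_0[of p n] by (auto simp: bhargava_exponent_finite)
  qed auto
  also have "\<dots> = (\<Prod>p | prime p \<and> p < 2 * n. p ^ bhargava_exponent p n)"
    by (rule prod.mono_neutral_cong_right) auto
  finally show ?thesis .
qed

end

theory Submission
  imports
    Defs
    "HOL-Real_Asymp.Real_Asymp"
    "HOL-Number_Theory.Prime_Powers"
begin

text \<open>
  By Legendre's formula the prime \<open>2\<close> contributes equally to the Bhargava factorial and to \<open>(2n)!\<close>, and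
  an odd prime \<open>p\<close> contributes \<open>ln p\<close> times the sum over \<open>k\<close> of
  \<open>\<lfloor>2n / ((p - 1) p^k)\<rfloor> - \<lfloor>2n / p^(k+1)\<rfloor>\<close> to the difference of the logarithms. For fixed \<open>p\<close> this sum
  is asymptotic to \<open>2n / (p - 1)\<^sup>2\<close>. For the primes beyond \<open>M\<close>, the terms with \<open>k \<ge> 1\<close> are bounded
  by a tail of the series for \<open>\<beta>\<close>, and those with \<open>k = 0\<close> by \<open>O(n ln M / M)\<close> through Abel summation.

  For the numerical value, \<open>\<beta> / 2\<close> is the sum of \<open>ln p / (p - 1)\<^sup>2\<close> over odd primes. The sums
  \<open>Q\<^sub>s = (\<Sum>p. ln p / (p^s - 1))\<close> equal \<open>-\<zeta>'(s) / \<zeta>(s)\<close>, which Euler-Maclaurin summation from \<open>16\<close>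
  evaluates to ten digits. Subtracting \<open>\<phi>(s) Q\<^sub>s\<close> for \<open>s = 2, ..., 7\<close> leaves a sum over primes whose
  part beyond \<open>13\<close> is at most \<open>1.4 * 10^(-8)\<close>, so that only the logarithms of \<open>2, 3, 5, 7, 11, 13\<close>
  are needed.
\<close>

section \<open>Euler-Maclaurin summation\<close>

text \<open>
  Throughout, \<open>g 1\<close> is the summand, \<open>g 0\<close> an antiderivative of it and \<open>g (i + 1)\<close> its \<open>i\<close>-th
  derivative. With \<open>B\<^sub>6(t)\<close> the Bernoulli polynomial, \<open>K(t) = (B\<^sub>6(t) - B\<^sub>6(0)) / 720\<close> lies between
  \<open>-1/15360\<close> and \<open>0\<close> on the unit interval, and \<open>H\<close> is the boundary term of the repeated integration by
  parts of \<open>K(t) * g 7 (a + t)\<close>. Monotonicity of \<open>H\<close> replaces the remainder integral.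
\<close>
lemma euler_maclaurin_step:
  fixes g :: "nat \<Rightarrow> real \<Rightarrow> real" and a :: real
  assumes deriv: "\<And>i x. i < 7 \<Longrightarrow> a \<le> x \<Longrightarrow> (g i has_real_derivative g (Suc i) x) (at x)"
    and nonneg: "\<And>x. a \<le> x \<Longrightarrow> g 7 x \<ge> 0"
  defines "\<delta> \<equiv> \<lambda>i. g i (a + 1) - g i a"
  shows "\<delta> 0 - (g 1 a + g 1 (a + 1)) / 2 + \<delta> 2 / 12 - \<delta> 4 / 720 \<le> 0" (is "?E \<le> 0")
    and "- \<delta> 6 / 15360 \<le> \<delta> 0 - (g 1 a + g 1 (a + 1)) / 2 + \<delta> 2 / 12 - \<delta> 4 / 720"
proof -
  define K where "K = (\<lambda>t::real. (t^6 - 3*t^5 + 5/2*t^4 - 1/2*t^2) / 720)"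
  define H where "H = (\<lambda>t::real. K t * g 6 (a + t)
     - (6*t^5 - 15*t^4 + 10*t^3 - t) / 720 * g 5 (a + t)
     + (30*t^4 - 60*t^3 + 30*t^2 - 1) / 720 * g 4 (a + t)
     - (120*t^3 - 180*t^2 + 60*t) / 720 * g 3 (a + t)
     + (360*t^2 - 360*t + 60) / 720 * g 2 (a + t)
     - (720*t - 360) / 720 * g 1 (a + t) + g 0 (a + t))"
  have dg: "((\<lambda>t. g i (a + t)) has_real_derivative g (Suc i) (a + t)) (at t)"
    if "i < 7" "0 \<le> t" for i t
    using deriv[of i "a + t"] that DERIV_shift[of "g i" "g (Suc i) (a + t)" t a]
    by (simp add: add.commute)
  note dgs = dg[of 0] dg[of 1] dg[of 2] dg[of 3] dg[of 4] dg[of 5] dg[of 6]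
  \<comment> \<open>Each coefficient in \<open>H\<close> is the derivative of the preceding one and
    the signs alternate, so the product rule telescopes and only the term with \<open>g 7\<close>
    survives.\<close>
  have dH: "(H has_real_derivative K t * g 7 (a + t)) (at t)" if "0 \<le> t" for t
    unfolding H_def K_def
    by (rule derivative_eq_intros dgs refl | simp add: that)+
       (simp add: eval_nat_numeral field_simps)
  \<comment> \<open>With \<open>u = t * (1 - t)\<close> this is
    \<open>- u^2 * (1 + 2 * u) / 1440\<close>: the sign becomes visible, and the minimum, at
    \<open>u = 1/4\<close>, is \<open>- 1/15360\<close>.\<close>
  have K_eq: "K t = - (t\<^sup>2 * (1 - t)\<^sup>2 * (1 + 2 * (t * (1 - t)))) / 1440" for t
    unfolding K_def by (simp add: eval_nat_numeral field_simps)
  have K_bounds: "K t \<le> 0" "- 1/15360 \<le> K t" if "0 \<le> t" "t \<le> 1" for t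
  proof -
    have u: "0 \<le> t * (1 - t)" using that by simp
    have "0 \<le> (t - 1/2)\<^sup>2" by simp
    hence u': "t * (1 - t) \<le> 1/4" by (simp add: power2_eq_square algebra_simps)
    have K: "K t = - ((t * (1 - t))\<^sup>2 * (1 + 2 * (t * (1 - t)))) / 1440"
      by (simp add: K_eq power_mult_distrib)
    show "K t \<le> 0" unfolding K using u by simp
    have "(t * (1 - t))\<^sup>2 * (1 + 2 * (t * (1 - t))) \<le> (1/4)\<^sup>2 * (1 + 2 * (1/4))"
      using u u' by (intro mult_mono power_mono) auto
    also have "\<dots> = 3/32" by (simp add: power2_eq_square)
    finally show "- 1/15360 \<le> K t" unfolding K by simp
  qed
  \<comment> \<open>At both ends the coefficients of \<open>g 6\<close>, \<open>g 5\<close> and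
    \<open>g 3\<close> vanish. Those of \<open>g 4\<close> and \<open>g 2\<close> take equal values
    there, which gives differences, and that of \<open>g 1\<close> takes opposite values, which
    gives the trapezoidal term.\<close>
  have ends: "H 1 - H 0 = ?E"
    unfolding H_def K_def \<delta>_def by (simp add: field_simps)
  have "H 1 \<le> H 0"
    using dH K_bounds nonneg
    by (intro DERIV_nonpos_imp_nonincreasing[of 0 1 H]) (auto intro!: exI mult_nonpos_nonneg)
  thus "?E \<le> 0" using ends by linarith
  \<comment> \<open>The added term makes the derivative
    \<open>(K t + 1/15360) * g 7 (a + t)\<close>, so the lower bound on \<open>K\<close> yields
    monotonicity in the opposite direction.\<close>
  have "H 0 + g 6 (a + 0) / 15360 \<le> H 1 + g 6 (a + 1) / 15360"
  proof (intro DERIV_nonneg_imp_nondecreasing[of 0 1 "\<lambda>t. H t + g 6 (a + t) / 15360"] exI conjI)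
    fix t :: real assume t: "0 \<le> t" "t \<le> 1"
    show "((\<lambda>t. H t + g 6 (a + t) / 15360) has_real_derivative
            K t * g 7 (a + t) + g 7 (a + t) / 15360) (at t)"
      using dH[OF t(1)] dg[of 6 t] t by (auto intro!: derivative_eq_intros)
    have "0 \<le> (K t + 1/15360) * g 7 (a + t)"
      using K_bounds[OF t] nonneg[of "a + t"] t by (intro mult_nonneg_nonneg) auto
    thus "K t * g 7 (a + t) + g 7 (a + t) / 15360 \<ge> 0" by (simp add: algebra_simps)
  qed simp
  hence "- \<delta> 6 / 15360 \<le> H 1 - H 0" unfolding \<delta>_def by (simp add: field_simps)
  thus "- \<delta> 6 / 15360 \<le> ?E" using ends by linarith
qed

text \<open>By the one-step bounds, each summand lies between the differences of two sequences
  \<open>F\<close> and \<open>F'\<close> that tend to 0; telescoping squeezes the series between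
  \<open>F 0\<close> and \<open>F' 0\<close>.\<close>

lemma euler_maclaurin_tail:
  fixes g :: "nat \<Rightarrow> real \<Rightarrow> real" and a :: real
  assumes deriv: "\<And>i x. i < 7 \<Longrightarrow> a \<le> x \<Longrightarrow> (g i has_real_derivative g (Suc i) x) (at x)"
    and nonneg: "\<And>x. a \<le> x \<Longrightarrow> g 7 x \<ge> 0"
    and lim: "\<And>i. i < 7 \<Longrightarrow> (g i \<longlongrightarrow> 0) at_top"
  defines "M \<equiv> - g 0 a + g 1 a / 2 - g 2 a / 12 + g 4 a / 720"
  shows "summable (\<lambda>n. g 1 (a + real n))"
    and "(\<Sum>n. g 1 (a + real n)) \<in> {M .. M - g 6 a / 15360}"
proof -
  define F where "F = (\<lambda>n. let x = a + real n in - g 0 x + g 1 x / 2 - g 2 x / 12 + g 4 x / 720)"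
  define F' where "F' = (\<lambda>n. F n - g 6 (a + real n) / 15360)"
  have lim': "(\<lambda>n. g i (a + real n)) \<longlonglongrightarrow> 0" if "i < 7" for i
    by (rule filterlim_compose[OF lim[OF that]]) real_asymp
  have "F \<longlonglongrightarrow> - 0 + 0 / 2 - 0 / 12 + 0 / 720"
    unfolding F_def Let_def by (intro tendsto_intros lim') auto
  hence F0: "F \<longlonglongrightarrow> 0" by simp
  have "F' \<longlonglongrightarrow> 0 - 0 / 15360"
    unfolding F'_def by (intro tendsto_intros lim' F0) auto
  hence F'0: "F' \<longlonglongrightarrow> 0" by simp
  have step: "F n - F (Suc n) \<le> g 1 (a + real n)" "g 1 (a + real n) \<le> F' n - F' (Suc n)" for n
    using euler_maclaurin_step[of "a + real n" g] deriv nonneg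
    by (auto simp: F_def F'_def Let_def field_simps)
  have sF: "(\<lambda>n. F n - F (Suc n)) sums F 0" using telescope_sums'[OF F0] by simp
  have sF': "(\<lambda>n. F' n - F' (Suc n)) sums F' 0" using telescope_sums'[OF F'0] by simp
  \<comment> \<open>The sign of \<open>g 1\<close> is unknown, so the comparison is made for its
    nonnegative excess over the lower telescoping term.\<close>
  have "summable (\<lambda>n. g 1 (a + real n) - (F n - F (Suc n)))"
  proof (rule summable_comparison_test')
    show "summable (\<lambda>n. (F' n - F' (Suc n)) - (F n - F (Suc n)))"
      by (rule summable_diff[OF sums_summable[OF sF'] sums_summable[OF sF]])
    show "norm (g 1 (a + real n) - (F n - F (Suc n))) \<le> (F' n - F' (Suc n)) - (F n - F (Suc n))"
      for n using step[of n] by simp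
  qed
  from summable_add[OF this sums_summable[OF sF]]
  show sg: "summable (\<lambda>n. g 1 (a + real n))" by simp
  have "F 0 \<le> (\<Sum>n. g 1 (a + real n))"
    using sums_le[OF step(1) sF summable_sums[OF sg]] .
  moreover have "(\<Sum>n. g 1 (a + real n)) \<le> F' 0"
    using sums_le[OF step(2) summable_sums[OF sg] sF'] .
  ultimately show "(\<Sum>n. g 1 (a + real n)) \<in> {M .. M - g 6 a / 15360}"
    by (simp add: F_def F'_def M_def)
qed

section \<open>The functions \<open>(a ln x + b) / x^r\<close> and their derivatives\<close>

definition log_pow :: "real \<Rightarrow> real \<Rightarrow> nat \<Rightarrow> real \<Rightarrow> real" where
  "log_pow a b r x = (a * ln x + b) / x ^ r"

lemma log_pow_has_derivative:
  assumes "x > 0"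
  shows "(log_pow a b r has_real_derivative log_pow (- real r * a) (a - real r * b) (Suc r) x) (at x)"
proof -
  have pow: "((\<lambda>x. x ^ r) has_real_derivative real r * x ^ r / x) (at x)"
    using DERIV_pow[of r x UNIV] assms by (cases r) auto
  have ln: "(ln has_real_derivative 1 / x) (at x)" using assms by (rule DERIV_ln_divide)
  show ?thesis unfolding log_pow_def
    by (rule derivative_eq_intros pow ln refl)+ (use assms in \<open>auto simp: field_simps\<close>)
qed

lemma log_pow_tendsto_0:
  assumes "r > 0"
  shows "(log_pow a b r \<longlongrightarrow> 0) at_top"
proof (rule Lim_null_comparison)
  show "((\<lambda>x::real. \<bar>a * ln x + b\<bar> / x) \<longlongrightarrow> 0) at_top" 
  proof -
    have "((\<lambda>x::real. (a * ln x + b) / x) \<longlongrightarrow> 0) at_top" by real_asymp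
    hence "((\<lambda>x::real. \<bar>(a * ln x + b) / x\<bar>) \<longlongrightarrow> 0) at_top" by (rule tendsto_rabs_zero)
    thus ?thesis
      by (rule Lim_transform_eventually) (use eventually_gt_at_top[of 0] in eventually_elim, simp)
  qed
  show "eventually (\<lambda>x. norm (log_pow a b r x) \<le> \<bar>a * ln x + b\<bar> / x) at_top"
    using eventually_ge_at_top[of 1]
  proof eventually_elim
    case (elim x)
    have "x \<le> x ^ r" using elim assms by (simp add: self_le_power)
    thus ?case using elim by (auto simp: log_pow_def intro!: divide_left_mono mult_pos_pos)
  qed
qed

text \<open>The recursion is the derivative rule of \<open>log_pow\<close>: the exponent rises by
  one and the pair \<open>(c, d)\<close> of coefficients changes linearly. All derivatives thus
  become numerals by rewriting.\<close>

primrec log_pow_coeffs :: "nat \<Rightarrow> real \<Rightarrow> real \<Rightarrow> nat \<Rightarrow> real \<times> real" where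
  "log_pow_coeffs r a b 0 = (a, b)"
| "log_pow_coeffs r a b (Suc i) =
     (let (c, d) = log_pow_coeffs r a b i in (- real (r + i) * c, c - real (r + i) * d))"

definition log_pow_deriv :: "nat \<Rightarrow> real \<Rightarrow> real \<Rightarrow> nat \<Rightarrow> real \<Rightarrow> real" where
  "log_pow_deriv r a b i =
     log_pow (fst (log_pow_coeffs r a b i)) (snd (log_pow_coeffs r a b i)) (r + i)"

lemma ln_ge_2: "2 \<le> ln x" if "x \<ge> 16" for x :: real
proof -
  have "(2::real) \<le> 4 * ln 2" using ln2_ge_two_thirds by simp
  also have "4 * ln 2 = ln (2 ^ 4 :: real)" by (subst ln_realpow) auto
  also have "\<dots> \<le> ln x" using that by simp
  finally show ?thesis .
qed

text \<open>The function of index 7 has a numerator \<open>c * ln x + d\<close>. Since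
  \<open>ln x \<ge> 2\<close> from 16 on, \<open>c \<ge> 0\<close> and
  \<open>2 * c + d \<ge> 0\<close> make it nonnegative, and these are conditions on
  numerals.\<close>

lemma log_pow_tail:
  fixes a b :: real and r :: nat
  assumes r: "r > 0"
    and c: "fst (log_pow_coeffs r a b 7) \<ge> 0"
      "2 * fst (log_pow_coeffs r a b 7) + snd (log_pow_coeffs r a b 7) \<ge> 0"
  defines "M \<equiv> - log_pow_deriv r a b 0 16 + log_pow_deriv r a b 1 16 / 2
    - log_pow_deriv r a b 2 16 / 12 + log_pow_deriv r a b 4 16 / 720"
  shows "summable (\<lambda>n. log_pow_deriv r a b 1 (real (n + 16)))"
    and "(\<Sum>n. log_pow_deriv r a b 1 (real (n + 16)))
            \<in> {M .. M - log_pow_deriv r a b 6 16 / 15360}"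
proof -
  have *: "(log_pow_deriv r a b i has_real_derivative log_pow_deriv r a b (Suc i) x) (at x)"
    if "16 \<le> x" for i x
    using log_pow_has_derivative[of x "fst (log_pow_coeffs r a b i)" "snd (log_pow_coeffs r a b i)" "r + i"] that
    by (simp add: log_pow_deriv_def case_prod_unfold Let_def)
  have **: "0 \<le> log_pow_deriv r a b 7 x" if "16 \<le> x" for x
  proof -
    have "fst (log_pow_coeffs r a b 7) * 2 \<le> fst (log_pow_coeffs r a b 7) * ln x"
      using c(1) ln_ge_2[OF that] by (rule mult_left_mono[rotated])
    hence "0 \<le> fst (log_pow_coeffs r a b 7) * ln x + snd (log_pow_coeffs r a b 7)"
      using c(2) by linarith
    thus ?thesis using that by (simp add: log_pow_deriv_def log_pow_def)
  qed
  have ***: "(log_pow_deriv r a b i \<longlongrightarrow> 0) at_top" for i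
    unfolding log_pow_deriv_def by (rule log_pow_tendsto_0) (use r in simp)
  note em = euler_maclaurin_tail[of 16 "log_pow_deriv r a b", OF * ** ***]
  show "summable (\<lambda>n. log_pow_deriv r a b 1 (real (n + 16)))"
    using em(1) by (simp add: add.commute)
  show "(\<Sum>n. log_pow_deriv r a b 1 (real (n + 16)))
            \<in> {M .. M - log_pow_deriv r a b 6 16 / 15360}"
    using em(2) unfolding M_def by (simp add: add.commute)
qed

section \<open>The sums of \<open>ln p / (p^s - 1)\<close>\<close>

text \<open>The divisor sum of \<open>mangoldt\<close> is \<open>ln\<close>, so multiplying
  Dirichlet series gives \<open>V * Z = L\<close>. In \<open>V\<close>, the powers of a single prime
  form a geometric series with sum \<open>ln p / (p^s - 1)\<close>.\<close>

lemma has_sum_ln_over_primes: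
  fixes s :: nat
  assumes s: "s > 0"
    and L: "((\<lambda>n. ln (real n) / real n ^ s) has_sum L) {0<..}"
    and Z: "((\<lambda>n. 1 / real n ^ s) has_sum Z) {0<..}"
  shows "((\<lambda>p. ln (real p) / (real p ^ s - 1)) has_sum (L / Z)) {p. prime p}"
proof -
  have "(\<lambda>n. mangoldt n / real n ^ s) summable_on {0<..}"
    by (rule summable_on_comparison_test[OF has_sum_imp_summable[OF L]])
       (auto intro!: divide_right_mono divide_nonneg_nonneg mangoldt_le mangoldt_nonneg)
  then obtain V where V: "((\<lambda>n. mangoldt n / real n ^ s) has_sum V) {0<..}"
    using has_sum_infsum by blast
  have "((\<lambda>(d, m). mangoldt d / real d ^ s * (1 / real m ^ s)) has_sum (V * Z)) ({0<..} \<times> {0<..})"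
  proof (rule has_sum_SigmaI)
    show inner: "((\<lambda>m. case (d, m) of (d, m) \<Rightarrow> mangoldt d / real d ^ s * (1 / real m ^ s))
        has_sum mangoldt d / real d ^ s * Z) {0<..}" for d
      using has_sum_cmult_right[OF Z, of "mangoldt d / real d ^ s"] by simp
    show outer: "((\<lambda>d. mangoldt d / real d ^ s * Z) has_sum V * Z) {0<..}"
      using has_sum_cmult_left[OF V] by simp
    show "(\<lambda>(d, m). mangoldt d / real d ^ s * (1 / real m ^ s)) summable_on ({0<..} \<times> {0<..})"
      by (rule summable_on_SigmaI[OF inner has_sum_imp_summable[OF outer]])
         (auto intro!: divide_nonneg_nonneg mangoldt_nonneg)
  qed
  \<comment> \<open>Pairs are regrouped by their product \<open>n = d * m\<close>, with
    \<open>d\<close> running over the divisors of \<open>n\<close>.\<close>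
  also have "?this \<longleftrightarrow> ((\<lambda>(n, d). mangoldt d / real n ^ s) has_sum (V * Z))
      (Sigma {0<..} (\<lambda>n. {d. d dvd n}))"
    by (rule has_sum_reindex_bij_witness[of _ "\<lambda>(n, d). (d, n div d)" "\<lambda>(d, m). (d * m, d)"])
       (auto simp: power_mult_distrib intro: Nat.gr0I)
  finally have "((\<lambda>n. ln (real n) / real n ^ s) has_sum (V * Z)) {0<..}"
  proof (rule has_sum_SigmaD)
    fix n :: nat assume "n \<in> {0<..}"
    hence "finite {d. d dvd n}" "(\<Sum>d | d dvd n. mangoldt d) = ln (real n)"
      using mangoldt_sum[of n, where ?'a = real] by auto
    thus "((\<lambda>d. case (n, d) of (n, d) \<Rightarrow> mangoldt d / real n ^ s) has_sum
        ln (real n) / real n ^ s) {d. d dvd n}"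
      by (intro has_sum_finiteI) (auto simp flip: sum_divide_distrib)
  qed
  hence "L = V * Z" using L has_sum_unique by blast
  \<comment> \<open>The term at \<open>n = 1\<close> gives \<open>1 \<le> Z\<close>, which permits
    the division by \<open>Z\<close>.\<close>
  moreover have "(\<Sum>n\<in>{1}. 1 / real n ^ s) \<le> Z"
    by (rule finite_sum_le_has_sum[OF Z]) auto
  ultimately have V_eq: "V = L / Z" by simp
  have "((\<lambda>n. mangoldt n / real n ^ s) has_sum V) {0<..} \<longleftrightarrow>
      ((\<lambda>n. mangoldt n / real n ^ s) has_sum V) (Collect primepow)"
    by (rule has_sum_cong_neutral) (auto simp: mangoldt_def primepow_gt_0_nat)
  also have "\<dots> \<longleftrightarrow> ((\<lambda>x. mangoldt (case x of (p, k) \<Rightarrow> p ^ Suc k)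
      / real (case x of (p, k) \<Rightarrow> p ^ Suc k) ^ s) has_sum V) (Collect prime \<times> UNIV)"
    by (rule has_sum_reindex_bij_betw[OF bij_betw_primepows, symmetric])
  finally have "((\<lambda>x. mangoldt (case x of (p, k) \<Rightarrow> p ^ Suc k)
      / real (case x of (p, k) \<Rightarrow> p ^ Suc k) ^ s) has_sum V) (Collect prime \<times> UNIV)"
    using V by simp
  hence "((\<lambda>p. ln (real p) / (real p ^ s - 1)) has_sum V) (Collect prime)"
  proof (rule has_sum_SigmaD)
    fix p :: nat assume "p \<in> Collect prime"
    hence p: "prime p" by simp
    define x where "x = 1 / real p ^ s"
    have pos: "real p ^ s > 1" using prime_gt_1_nat[OF p] s by simp
    hence x: "0 < x" "x < 1" using prime_gt_0_nat[OF p] by (auto simp: x_def)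
    have "(\<lambda>k. ln (real p) * x * x ^ k) sums (ln (real p) * x * (1 / (1 - x)))"
      using x by (intro sums_mult geometric_sums) simp
    also have "(\<lambda>k. ln (real p) * x * x ^ k) = (\<lambda>k. mangoldt (p ^ Suc k) / real (p ^ Suc k) ^ s)"
    proof
      fix k
      have "real (p ^ Suc k) ^ s = (real p ^ s) ^ Suc k"
        by (simp only: of_nat_power power_mult [symmetric] mult.commute)
      moreover have "mangoldt (p ^ Suc k) = ln (real p)"
        using mangoldt_primepow'[OF p, of "Suc k", where ?'a = real] by (simp del: power_Suc)
      ultimately show "ln (real p) * x * x ^ k = mangoldt (p ^ Suc k) / real (p ^ Suc k) ^ s"
        by (simp add: x_def power_divide del: of_nat_power)
    qed
    also have "ln (real p) * x * (1 / (1 - x)) = ln (real p) / (real p ^ s - 1)"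
      using pos by (simp add: x_def field_simps)
    finally show "((\<lambda>k. mangoldt (case (p, k) of (p, k) \<Rightarrow> p ^ Suc k)
        / real (case (p, k) of (p, k) \<Rightarrow> p ^ Suc k) ^ s) has_sum
        ln (real p) / (real p ^ s - 1)) UNIV"
      unfolding prod.case
      by (rule sums_nonneg_imp_has_sum) (intro divide_nonneg_nonneg mangoldt_nonneg, simp)
  qed
  thus ?thesis by (simp add: V_eq)
qed

section \<open>Logarithms of the integers up to 16\<close>

lemma ln_prime_bounds:
  "ln (2::real) \<in> {0.6931471805 .. 0.6931471806}" "ln (3::real) \<in> {1.0986122886 .. 1.0986122887}"
  "ln (5::real) \<in> {1.6094379124 .. 1.6094379125}" "ln (7::real) \<in> {1.9459101490 .. 1.9459101491}"
  "ln (11::real) \<in> {2.3978952727 .. 2.3978952728}" "ln (13::real) \<in> {2.5649493574 .. 2.5649493575}"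
proof -
  \<comment> \<open>The series for \<open>ln\<close> converges fast at ratios close to 1, such as
    \<open>8/7\<close>, from which \<open>ln 7 = 3 * ln 2 - ln (8/7)\<close>. Twelve digits leave
    room for the errors that add up.\<close>
  have l2: "ln (2::real) \<in> {0.693147180559 .. 0.693147180560}"
    using ln_approx_bounds[of "2" 12] by (simp add: eval_nat_numeral)
  have l3_2: "ln (3/2::real) \<in> {0.405465108108 .. 0.405465108109}"
    using ln_approx_bounds[of "3/2" 9] by (simp add: eval_nat_numeral)
  have l5_4: "ln (5/4::real) \<in> {0.223143551314 .. 0.223143551315}"
    using ln_approx_bounds[of "5/4" 7] by (simp add: eval_nat_numeral)
  have l8_7: "ln (8/7::real) \<in> {0.133531392624 .. 0.133531392625}"
    using ln_approx_bounds[of "8/7" 6] by (simp add: eval_nat_numeral)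
  have l12_11: "ln (12/11::real) \<in> {0.087011376989 .. 0.087011376990}"
    using ln_approx_bounds[of "12/11" 5] by (simp add: eval_nat_numeral)
  have l13_12: "ln (13/12::real) \<in> {0.080042707673 .. 0.080042707674}"
    using ln_approx_bounds[of "13/12" 5] by (simp add: eval_nat_numeral)
  have ln4: "ln (4::real) = 2 * ln 2" and ln8: "ln (8::real) = 3 * ln 2"
    and ln12: "ln (12::real) = 2 * ln 2 + ln 3"
    using ln_realpow[of 2 2] ln_realpow[of 2 3] ln_mult[of 4 "3::real"] by simp_all
  show "ln (2::real) \<in> {0.6931471805 .. 0.6931471806}" using l2 by simp
  show l3: "ln (3::real) \<in> {1.0986122886 .. 1.0986122887}"
    using l2 l3_2 by (simp add: ln_div)
  show "ln (5::real) \<in> {1.6094379124 .. 1.6094379125}"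
    using l2 l5_4 by (simp add: ln_div ln4)
  show "ln (7::real) \<in> {1.9459101490 .. 1.9459101491}"
    using l2 l8_7 by (simp add: ln_div ln8)
  show "ln (11::real) \<in> {2.3978952727 .. 2.3978952728}"
    using l2 l3_2 l12_11 by (simp add: ln_div ln12)
  show "ln (13::real) \<in> {2.5649493574 .. 2.5649493575}"
    using l2 l3_2 l13_12 by (simp add: ln_div ln12)
qed

lemma ln_composites:
  "ln (4::real) = 2 * ln 2" "ln (6::real) = ln 2 + ln 3" "ln (8::real) = 3 * ln 2"
  "ln (9::real) = 2 * ln 3" "ln (10::real) = ln 2 + ln 5" "ln (12::real) = 2 * ln 2 + ln 3"
  "ln (14::real) = ln 2 + ln 7" "ln (15::real) = ln 3 + ln 5" "ln (16::real) = 4 * ln 2"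
  using ln_realpow[of 2 2] ln_realpow[of 2 3] ln_realpow[of 2 4] ln_realpow[of 3 2]
    ln_mult[of 2 "3::real"] ln_mult[of 2 "5::real"] ln_mult[of 4 "3::real"]
    ln_mult[of 2 "7::real"] ln_mult[of 3 "5::real"]
  by simp_all

text \<open>The condition \<open>f 0 = 0\<close> holds for \<open>1 / n^s\<close> and \<open>ln n / n^s\<close> because \<open>1 / 0 = 0\<close>.\<close>
lemma has_sum_positive_nat_split:
  fixes f :: "nat \<Rightarrow> real"
  assumes nonneg: "\<And>n. f n \<ge> 0" and zero: "f 0 = 0" and summable: "summable (\<lambda>n. f (n + k))"
  shows "(f has_sum ((\<Sum>n<k. f n) + (\<Sum>n. f (n + k)))) {0<..}"
proof -
  have sf: "summable f" using summable summable_iff_shift[of f k] by simp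
  hence "f sums ((\<Sum>n<k. f n) + (\<Sum>n. f (n + k)))"
    using suminf_split_initial_segment[OF sf, of k] by (simp add: sums_iff add.commute)
  hence "(f has_sum ((\<Sum>n<k. f n) + (\<Sum>n. f (n + k)))) UNIV"
    using nonneg by (rule sums_nonneg_imp_has_sum)
  also have "?this \<longleftrightarrow> ?thesis"
    by (rule has_sum_cong_neutral) (use zero in auto)
  finally show ?thesis .
qed

text \<open>The parameters \<open>0\<close> and \<open>- 1 / r\<close> encode the antiderivative
  \<open>- 1 / (r * x^r)\<close> of \<open>1 / x^(r + 1)\<close>, so index 1 is the summand. Both
  bounds are then inequalities between numerals.\<close>

lemma zeta_sum_bounds:
  fixes r :: nat
  assumes r: "r > 0"
    and c: "0 \<le> snd (log_pow_coeffs r 0 (- 1 / r) 7)"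
  defines "g \<equiv> \<lambda>i. log_pow_deriv r 0 (- 1 / r) i 16"
  assumes bounds: "lo \<le> (\<Sum>n<16. 1 / real n ^ Suc r) - g 0 + g 1 / 2 - g 2 / 12 + g 4 / 720"
      "(\<Sum>n<16. 1 / real n ^ Suc r) - g 0 + g 1 / 2 - g 2 / 12 + g 4 / 720 - g 6 / 15360 \<le> hi"
  obtains Z where "((\<lambda>n. 1 / real n ^ Suc r) has_sum Z) {0<..}" "Z \<in> {lo .. hi}"
proof -
  have fst0: "fst (log_pow_coeffs r 0 (- 1 / r) i) = 0" for i
    by (induction i) (simp_all add: case_prod_unfold Let_def)
  have "log_pow_deriv r 0 (- 1 / r) 1 x = 1 / x ^ Suc r" for x
    using r by (simp add: log_pow_deriv_def log_pow_def)
  with log_pow_tail[of r 0 "- 1 / r"] r c fst0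
  have tail: "summable (\<lambda>n. 1 / real (n + 16) ^ Suc r)"
    "(\<Sum>n. 1 / real (n + 16) ^ Suc r)
       \<in> {- g 0 + g 1 / 2 - g 2 / 12 + g 4 / 720 .. - g 0 + g 1 / 2 - g 2 / 12 + g 4 / 720 - g 6 / 15360}"
    unfolding g_def by simp_all
  show ?thesis
    by (rule that[OF has_sum_positive_nat_split[OF _ _ tail(1)]]) (use tail(2) bounds in simp_all)
qed

text \<open>Integration by parts gives the antiderivative
  \<open>- ln x / (r * x^r) - 1 / (r^2 * x^r)\<close> of \<open>ln x / x^(r + 1)\<close>, whence the
  two parameters.\<close>

lemma log_sum_bounds:
  fixes r :: nat
  assumes r: "r > 0"
    and c: "fst (log_pow_coeffs r (- 1 / r) (- 1 / r\<^sup>2) 7) \<ge> 0"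
      "2 * fst (log_pow_coeffs r (- 1 / r) (- 1 / r\<^sup>2) 7) + snd (log_pow_coeffs r (- 1 / r) (- 1 / r\<^sup>2) 7) \<ge> 0"
  defines "g \<equiv> \<lambda>i. log_pow_deriv r (- 1 / r) (- 1 / r\<^sup>2) i 16"
  assumes bounds: "lo \<le> (\<Sum>n<16. ln (real n) / real n ^ Suc r) - g 0 + g 1 / 2 - g 2 / 12 + g 4 / 720"
      "(\<Sum>n<16. ln (real n) / real n ^ Suc r) - g 0 + g 1 / 2 - g 2 / 12 + g 4 / 720 - g 6 / 15360 \<le> hi"
  obtains L where "((\<lambda>n. ln (real n) / real n ^ Suc r) has_sum L) {0<..}" "L \<in> {lo .. hi}"
proof -
  have "log_pow_deriv r (- 1 / r) (- 1 / r\<^sup>2) 1 x = ln x / x ^ Suc r" for x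
    using r by (simp add: log_pow_deriv_def log_pow_def power2_eq_square)
  with log_pow_tail[of r "- 1 / r" "- 1 / r\<^sup>2"] r c
  have tail: "summable (\<lambda>n. ln (real (n + 16)) / real (n + 16) ^ Suc r)"
    "(\<Sum>n. ln (real (n + 16)) / real (n + 16) ^ Suc r)
       \<in> {- g 0 + g 1 / 2 - g 2 / 12 + g 4 / 720 .. - g 0 + g 1 / 2 - g 2 / 12 + g 4 / 720 - g 6 / 15360}"
    unfolding g_def by simp_all
  have nonneg: "0 \<le> ln (real n) / real n ^ Suc r" for n
    by (cases "n = 0") simp_all
  show ?thesis
    by (rule that[OF has_sum_positive_nat_split[OF nonneg _ tail(1)]]) (use tail(2) bounds in simp_all)
qed

text \<open>This and the five analogous enclosures below are narrower than \<open>10^(-9)\<close>.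
  Their weights in \<open>\<beta> / 2\<close> add up to 17, so together they cost less than
  \<open>3.4 * 10^(-8)\<close> in \<open>\<beta>\<close>.\<close>

lemma prime_sum_2:
  obtains Q where "((\<lambda>p. ln (real p) / (real p ^ 2 - 1)) has_sum Q) {p. prime p}"
    "Q \<in> {0.5699609927 .. 0.5699609935}"
proof -
  obtain Z where Z: "((\<lambda>n. 1 / real n ^ 2) has_sum Z) {0<..}" "Z \<in> {1.6449340667 .. 1.6449340670}"
    by (rule zeta_sum_bounds[of 1 "1.6449340667" "1.6449340670"])
       (simp_all add: eval_nat_numeral log_pow_deriv_def log_pow_def)
  \<comment> \<open>Every logarithm up to \<open>ln 16\<close> reduces to those of the six primes,
    and distributing the divisions leaves inequalities linear in these.\<close>
  obtain L where L: "((\<lambda>n. ln (real n) / real n ^ 2) has_sum L) {0<..}" "L \<in> {0.9375482538 .. 0.9375482548}"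
    by (rule log_sum_bounds[of 1 "0.9375482538" "0.9375482548"])
       (use ln_prime_bounds in
         \<open>auto simp: eval_nat_numeral log_pow_deriv_def log_pow_def ln_composites
            add_divide_distrib diff_divide_distrib\<close>)
  show ?thesis
  proof (rule that[OF has_sum_ln_over_primes[OF _ L(1) Z(1)]])
    show "L / Z \<in> {0.5699609927 .. 0.5699609935}"
      using L(2) Z(2) by (simp add: field_simps)
  qed simp
qed

lemma prime_sum_3:
  obtains Q where "((\<lambda>p. ln (real p) / (real p ^ 3 - 1)) has_sum Q) {p. prime p}"
    "Q \<in> {0.1648226818 .. 0.1648226826}"
proof -
  obtain Z where Z: "((\<lambda>n. 1 / real n ^ 3) has_sum Z) {0<..}" "Z \<in> {1.2020569031 .. 1.2020569032}"
    by (rule zeta_sum_bounds[of 2 "1.2020569031" "1.2020569032"])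
       (simp_all add: eval_nat_numeral log_pow_deriv_def log_pow_def)
  obtain L where L: "((\<lambda>n. ln (real n) / real n ^ 3) has_sum L) {0<..}" "L \<in> {0.1981262425 .. 0.1981262433}"
    by (rule log_sum_bounds[of 2 "0.1981262425" "0.1981262433"])
       (use ln_prime_bounds in
         \<open>auto simp: eval_nat_numeral log_pow_deriv_def log_pow_def ln_composites
            add_divide_distrib diff_divide_distrib\<close>)
  show ?thesis
  proof (rule that[OF has_sum_ln_over_primes[OF _ L(1) Z(1)]])
    show "L / Z \<in> {0.1648226818 .. 0.1648226826}"
      using L(2) Z(2) by (simp add: field_simps)
  qed simp
qed

lemma prime_sum_4:
  obtains Q where "((\<lambda>p. ln (real p) / (real p ^ 4 - 1)) has_sum Q) {p. prime p}"
    "Q \<in> {0.0636697645 .. 0.0636697654}"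
proof -
  obtain Z where Z: "((\<lambda>n. 1 / real n ^ 4) has_sum Z) {0<..}" "Z \<in> {1.0823232337 .. 1.0823232338}"
    by (rule zeta_sum_bounds[of 3 "1.0823232337" "1.0823232338"])
       (simp_all add: eval_nat_numeral log_pow_deriv_def log_pow_def)
  obtain L where L: "((\<lambda>n. ln (real n) / real n ^ 4) has_sum L) {0<..}" "L \<in> {0.0689112655 .. 0.0689112663}"
    by (rule log_sum_bounds[of 3 "0.0689112655" "0.0689112663"])
       (use ln_prime_bounds in
         \<open>auto simp: eval_nat_numeral log_pow_deriv_def log_pow_def ln_composites
            add_divide_distrib diff_divide_distrib\<close>)
  show ?thesis
  proof (rule that[OF has_sum_ln_over_primes[OF _ L(1) Z(1)]])
    show "L / Z \<in> {0.0636697645 .. 0.0636697654}"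
      using L(2) Z(2) by (simp add: field_simps)
  qed simp
qed

lemma prime_sum_5:
  obtains Q where "((\<lambda>p. ln (real p) / (real p ^ 5 - 1)) has_sum Q) {p. prime p}"
    "Q \<in> {0.0275561918 .. 0.0275561926}"
proof -
  obtain Z where Z: "((\<lambda>n. 1 / real n ^ 5) has_sum Z) {0<..}" "Z \<in> {1.0369277551 .. 1.0369277552}"
    by (rule zeta_sum_bounds[of 4 "1.0369277551" "1.0369277552"])
       (simp_all add: eval_nat_numeral log_pow_deriv_def log_pow_def)
  obtain L where L: "((\<lambda>n. ln (real n) / real n ^ 5) has_sum L) {0<..}" "L \<in> {0.0285737802 .. 0.0285737809}"
    by (rule log_sum_bounds[of 4 "0.0285737802" "0.0285737809"])
       (use ln_prime_bounds in
         \<open>auto simp: eval_nat_numeral log_pow_deriv_def log_pow_def ln_composites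
            add_divide_distrib diff_divide_distrib\<close>)
  show ?thesis
  proof (rule that[OF has_sum_ln_over_primes[OF _ L(1) Z(1)]])
    show "L / Z \<in> {0.0275561918 .. 0.0275561926}"
      using L(2) Z(2) by (simp add: field_simps)
  qed simp
qed

lemma prime_sum_6:
  obtains Q where "((\<lambda>p. ln (real p) / (real p ^ 6 - 1)) has_sum Q) {p. prime p}"
    "Q \<in> {0.0126330687 .. 0.0126330694}"
proof -
  obtain Z where Z: "((\<lambda>n. 1 / real n ^ 6) has_sum Z) {0<..}" "Z \<in> {1.0173430619 .. 1.0173430620}"
    by (rule zeta_sum_bounds[of 5 "1.0173430619" "1.0173430620"])
       (simp_all add: eval_nat_numeral log_pow_deriv_def log_pow_def)
  obtain L where L: "((\<lambda>n. ln (real n) / real n ^ 6) has_sum L) {0<..}" "L \<in> {0.0128521648 .. 0.0128521655}"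
    by (rule log_sum_bounds[of 5 "0.0128521648" "0.0128521655"])
       (use ln_prime_bounds in
         \<open>auto simp: eval_nat_numeral log_pow_deriv_def log_pow_def ln_composites
            add_divide_distrib diff_divide_distrib\<close>)
  show ?thesis
  proof (rule that[OF has_sum_ln_over_primes[OF _ L(1) Z(1)]])
    show "L / Z \<in> {0.0126330687 .. 0.0126330694}"
      using L(2) Z(2) by (simp add: field_simps)
  qed simp
qed

lemma prime_sum_7:
  obtains Q where "((\<lambda>p. ln (real p) / (real p ^ 7 - 1)) has_sum Q) {p. prime p}"
    "Q \<in> {0.0059835582 .. 0.0059835590}"
proof -
  obtain Z where Z: "((\<lambda>n. 1 / real n ^ 7) has_sum Z) {0<..}" "Z \<in> {1.0083492773 .. 1.0083492774}"
    by (rule zeta_sum_bounds[of 6 "1.0083492773" "1.0083492774"])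
       (simp_all add: eval_nat_numeral log_pow_deriv_def log_pow_def)
  obtain L where L: "((\<lambda>n. ln (real n) / real n ^ 7) has_sum L) {0<..}" "L \<in> {0.0060335166 .. 0.0060335173}"
    by (rule log_sum_bounds[of 6 "0.0060335166" "0.0060335173"])
       (use ln_prime_bounds in
         \<open>auto simp: eval_nat_numeral log_pow_deriv_def log_pow_def ln_composites
            add_divide_distrib diff_divide_distrib\<close>)
  show ?thesis
  proof (rule that[OF has_sum_ln_over_primes[OF _ L(1) Z(1)]])
    show "L / Z \<in> {0.0059835582 .. 0.0059835590}"
      using L(2) Z(2) by (simp add: field_simps)
  qed simp
qed

section \<open>The constant\<close>

lemma geometric_tail_bounds:
  fixes z :: real
  assumes "0 \<le> z" "z \<le> 1/2"
  shows "z + z^2 + z^3 \<le> z / (1 - z)" "z / (1 - z) \<le> z + z^2 + z^3 + 2 * z^4"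
    "z / (1 - z) \<le> z + z^2 + 2 * z^3" "z / (1 - z) \<le> z + 2 * z^2"
proof -
  \<comment> \<open>The remainder \<open>z^k / (1 - z)\<close> of the geometric series is at most
    \<open>2 * z^k\<close> exactly because this product is nonnegative.\<close>
  have "0 \<le> z ^ k * (1 - 2 * z)" "0 \<le> z ^ k" for k using assms by auto
  note * = this(1)[of 2] this(1)[of 3] this(1)[of 4] this(2)[of 4] and pos = assms
  show "z + z^2 + z^3 \<le> z / (1 - z)" "z / (1 - z) \<le> z + z^2 + z^3 + 2 * z^4"
    "z / (1 - z) \<le> z + z^2 + 2 * z^3" "z / (1 - z) \<le> z + 2 * z^2"
    using * pos by (simp_all add: field_simps eval_nat_numeral)
qed

text \<open>
  Since \<open>\<Sum>d | d dvd n. \<phi>(d) = n\<close>, one has \<open>1 / (x - 1)\<^sup>2 = (\<Sum>s\<ge>2. \<phi>(s) / (x^s - 1))\<close>. Removing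
  the terms with \<open>s \<le> 7\<close> leaves a weight of order \<open>x^(-8)\<close>.
\<close>
definition residual_weight :: "real \<Rightarrow> real" where
  "residual_weight x = 1 / (x - 1)^2 - (1 / (x^2 - 1) + 2 * (1 / (x^3 - 1)) + 2 * (1 / (x^4 - 1))
     + 4 * (1 / (x^5 - 1)) + 2 * (1 / (x^6 - 1)) + 6 * (1 / (x^7 - 1)))"

text \<open>In powers of \<open>y = 1 / x\<close>, the two parts of the weight agree up to
  \<open>y^7\<close>. It remains to compare their terms from \<open>y^8\<close> on.\<close>

lemma residual_weight_bounds:
  assumes x: "x \<ge> 17"
  shows "0 \<le> residual_weight x" "residual_weight x \<le> 8 / x^8"
proof -
  define y where "y = 1 / x"
  have y: "0 < y" "y \<le> 1/17" using x by (auto simp: y_def field_simps)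
  have inv: "1 / (x^s - 1) = y^s / (1 - y^s)" if "s > 0" for s
  proof -
    have "x^s > 1" using x that by simp
    moreover have "x \<noteq> 0" using x by simp
    ultimately show ?thesis by (simp add: y_def power_divide field_simps)
  qed
  have small: "0 \<le> y^s" "y^s \<le> 1/2" if "s > 0" for s
  proof -
    have "y^s \<le> y^1" using y that by (intro power_decreasing) auto
    thus "0 \<le> y^s" "y^s \<le> 1/2" using y by auto
  qed
  have up: "y^(8+k) \<le> y^8 * (1/17)^k" for k
    unfolding power_add using y by (intro mult_left_mono power_mono) auto
  \<comment> \<open>The last summand is the closed form of the terms \<open>(m - 1) * y^m\<close>
    with \<open>m \<ge> 8\<close>.\<close>
  have main: "1 / (x - 1)^2 = y^2 + 2*y^3 + 3*y^4 + 4*y^5 + 5*y^6 + 6*y^7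
      + y^8 * ((7 - 6*y) / (1 - y)^2)"
  proof -
    have "1 / (x - 1)^2 = (y / (1 - y))^2" using x by (simp add: y_def power_divide field_simps)
    also have "\<dots> = y^2 + 2*y^3 + 3*y^4 + 4*y^5 + 5*y^6 + 6*y^7 + y^8 * ((7 - 6*y) / (1 - y)^2)"
      using y by (simp add: power_divide field_simps) (simp add: eval_nat_numeral algebra_simps)
    finally show ?thesis .
  qed
  have y8: "y^8 > 0" using y by simp
  \<comment> \<open>\<open>113 / 17\<close> is the value of \<open>7 - 6 * y\<close> at the largest
    admissible \<open>y = 1/17\<close>.\<close>
  have "113 / 17 \<le> (7 - 6*y) / 1" using y by simp
  also have "\<dots> \<le> (7 - 6*y) / (1 - y)^2"
    using y by (intro divide_left_mono power_le_one mult_pos_pos) auto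
  finally have "113 / 17 \<le> (7 - 6*y) / (1 - y)^2" .
  hence lo: "y^8 * (113 / 17) \<le> y^8 * ((7 - 6*y) / (1 - y)^2)"
    using y8 by (intro mult_left_mono) auto
  have "(16/17)^2 \<le> (1 - y)^2" using y by (intro power_mono) auto
  hence "(7 - 6*y) / (1 - y)^2 \<le> 7 / (16/17)^2" using y by (intro frac_le) auto
  also have "\<dots> \<le> 8" by (simp add: power2_eq_square)
  finally have hi: "y^8 * ((7 - 6*y) / (1 - y)^2) \<le> y^8 * 8"
    using y8 by (intro mult_left_mono) auto
  note g = geometric_tail_bounds[OF small]
  have pows: "(y^s)^m = y^(s * m)" for s m by (simp add: power_mult)
  have lows: "y^s \<le> y^s / (1 - y^s)" if "s > 0" for s
    using g(1)[of s] small[OF that] that by (smt (verit) zero_le_power)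
  have "y^3 + y^6 + y^9 \<le> y^3 / (1 - y^3)" using g(1)[of 3] by (simp add: pows)
  hence "y^3 + y^6 \<le> y^3 / (1 - y^3)" using small(1)[of 9] by linarith
  hence "y^2 + 2*y^3 + 3*y^4 + 4*y^5 + 5*y^6 + 6*y^7 \<le> 1 / (x^2 - 1) + 2 * (1 / (x^3 - 1))
      + 2 * (1 / (x^4 - 1)) + 4 * (1 / (x^5 - 1)) + 2 * (1 / (x^6 - 1)) + 6 * (1 / (x^7 - 1))"
    using g(1)[of 2] lows[of 4] lows[of 5] lows[of 6] lows[of 7] by (simp add: inv pows)
  hence "residual_weight x \<le> y^8 * 8"
    unfolding residual_weight_def main using hi by linarith
  thus "residual_weight x \<le> 8 / x^8" by (simp add: y_def power_divide)
  \<comment> \<open>Cutting the geometric series leaves at most \<open>6 * y^8\<close> plus higher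
    powers; for \<open>y \<le> 1/17\<close> these stay below
    \<open>y^8 * (113 / 17)\<close>.\<close>
  have "1 / (x^2 - 1) + 2 * (1 / (x^3 - 1)) + 2 * (1 / (x^4 - 1)) + 4 * (1 / (x^5 - 1))
      + 2 * (1 / (x^6 - 1)) + 6 * (1 / (x^7 - 1)) \<le> y^2 + 2*y^3 + 3*y^4 + 4*y^5 + 5*y^6 + 6*y^7
      + (6 * y^8 + 4 * y^9 + 8 * y^10 + 4 * y^12 + 12 * y^14)"
    using g(2)[of 2] g(3)[of 3] g(4)[of 4] g(4)[of 5] g(4)[of 6] g(4)[of 7]
    by (simp add: inv pows)
  also have "6 * y^8 + 4 * y^9 + 8 * y^10 + 4 * y^12 + 12 * y^14 \<le> y^8 * (113 / 17)"
  proof -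
    have "17 * y^9 \<le> y^8" "289 * y^10 \<le> y^8" "83521 * y^12 \<le> y^8" "24137569 * y^14 \<le> y^8"
      using up[of 1] up[of 2] up[of 4] up[of 6] by (simp_all add: power_divide)
    thus ?thesis using y8 by linarith
  qed
  finally show "0 \<le> residual_weight x"
    unfolding residual_weight_def main using lo by linarith
qed

text \<open>The tangent to \<open>ln\<close> at 16 already lies below \<open>x / 5\<close> from 17
  on. This lets an integer power of \<open>x\<close> dominate the terms of the residual sum.\<close>

lemma ln_le_div_5: "ln x \<le> x / 5" if "x \<ge> 17" for x :: real
proof -
  have "ln x = ln 16 + ln (x / 16)" using that by (simp add: ln_div)
  also have "ln (x / 16) \<le> x / 16 - 1" using that by (intro ln_le_minus_one) auto
  also have "ln (16::real) = 4 * ln 2" by (rule ln_composites)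
  finally show ?thesis using ln_prime_bounds(1) that by simp
qed

section \<open>The terms of \<open>\<beta>\<close> and its numerical enclosure\<close>

abbreviation beta_term :: "nat \<Rightarrow> real" where
  "beta_term p \<equiv> ln (real p) / (real p - 1) * (real p / real_of_int \<lceil>(real p - 1) / 2\<rceil> - 2)"

lemma beta_term_2: "beta_term 2 = 0"
proof -
  have "\<lceil>(1::real) / 2\<rceil> = 1" by (simp add: ceiling_eq_iff)
  thus ?thesis by simp
qed

lemma half_pred_odd_prime:
  assumes "prime p" "p \<noteq> 2"
  shows "real_of_int \<lceil>(real p - 1) / 2\<rceil> = (real p - 1) / 2"
proof -
  have "odd p" using assms primes_dvd_imp_eq two_is_prime_nat by blast
  then obtain k where "p = 2 * k + 1" by (auto elim: oddE)
  thus ?thesis by simp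
qed

lemma beta_term_odd:
  assumes "prime p" "p \<noteq> 2"
  shows "beta_term p = 2 * (ln (real p) / (real p - 1)^2)"
  using prime_gt_1_nat[OF assms(1)]
  by (simp add: half_pred_odd_prime[OF assms] field_simps power2_eq_square)

lemma primes_less_17: "{p::nat. prime p \<and> p < 17} = {2, 3, 5, 7, 11, 13}"
proof -
  have "p \<in> {2, 3, 5, 7, 11, 13}" if "prime p" "p < 17" for p :: nat
  proof -
    have "p \<in> {..<17}" using that by simp
    hence "p \<in> {0, 1, 2, 3, 4, 5, 6, 7, 8, 9, 10, 11, 12, 13, 14, 15, 16}"
      by (auto simp: lessThan_Suc eval_nat_numeral)
    thus ?thesis using that(1) by auto
  qed
  thus ?thesis by auto
qed

text \<open>Each term is at most \<open>(p / 5) * (8 / p^8)\<close>, so the sum is dominated by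
  \<open>8/5\<close> times the part of \<open>\<zeta>(7)\<close> from 17 on, taken over all
  integers.\<close>

lemma residual_sum:
  obtains V where "((\<lambda>p. ln (real p) * residual_weight (real p)) has_sum V) {p. prime p \<and> p \<ge> 17}"
    "V \<in> {0 .. 0.000000014}"
proof -
  define T where "T = {p::nat. prime p \<and> p \<ge> 17}"
  \<comment> \<open>The tail is about \<open>8 * 10^(-9)\<close> and arises as a difference, so more
    digits are needed here than for the quotient above; only the upper end matters.\<close>
  obtain Z where Z: "((\<lambda>n. 1 / real n ^ 7) has_sum Z) {0<..}" "Z \<in> {0 .. 1.008349277383}"
    by (rule zeta_sum_bounds[of 6 0 "1.008349277383"])
       (simp_all add: eval_nat_numeral log_pow_deriv_def log_pow_def)
  have "((\<lambda>n. 1 / real n ^ 7) has_sum (Z - (\<Sum>n\<in>{0<..<17}. 1 / real n ^ 7))) ({0<..} - {0<..<17})"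
    by (rule has_sum_Diff[OF Z(1)]) auto
  also have "{0<..} - {0<..<17} = {17::nat..}" by auto
  finally have tail: "((\<lambda>n. 8/5 * (1 / real n ^ 7)) has_sum
      (8/5 * (Z - (\<Sum>n\<in>{0<..<17}. 1 / real n ^ 7)))) {17..}" by (rule has_sum_cmult_right)
  have nonneg: "0 \<le> ln (real p) * residual_weight (real p)" if "p \<in> T" for p
    using that residual_weight_bounds(1)[of "real p"] by (auto simp: T_def)
  have le: "ln (real p) * residual_weight (real p) \<le> 8/5 * (1 / real p ^ 7)" if "p \<in> T" for p
  proof -
    have p: "real p \<ge> 17" using that by (simp add: T_def)
    have "ln (real p) * residual_weight (real p) \<le> real p / 5 * (8 / real p ^ 8)"
      using residual_weight_bounds[OF p] ln_le_div_5[OF p] p by (intro mult_mono) auto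
    also have "\<dots> = 8/5 * (1 / real p ^ 7)" using p by (simp add: eval_nat_numeral)
    finally show ?thesis .
  qed
  have "(\<lambda>n. 8/5 * (1 / real n ^ 7)) summable_on T"
    by (rule summable_on_subset[OF has_sum_imp_summable[OF tail]]) (auto simp: T_def)
  hence "(\<lambda>p. ln (real p) * residual_weight (real p)) summable_on T"
    by (rule summable_on_comparison_test) (use le nonneg in auto)
  then obtain V where V: "((\<lambda>p. ln (real p) * residual_weight (real p)) has_sum V) T"
    using has_sum_infsum by blast
  have "0 \<le> V" using V nonneg by (rule has_sum_nonneg)
  moreover have "V \<le> 8/5 * (Z - (\<Sum>n\<in>{0<..<17}. 1 / real n ^ 7))"
    by (rule has_sum_mono_neutral[OF V tail]) (use le in \<open>auto simp: T_def\<close>)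
  moreover have "(\<Sum>n\<in>{0<..<17::nat}. 1 / real n ^ 7) = (\<Sum>n<16. 1 / real (Suc n) ^ 7)"
    by (rule sum.reindex_bij_witness[of _ Suc "\<lambda>n. n - 1"]) auto
  moreover have "(\<Sum>n<16. 1 / real (Suc n) ^ 7) \<ge> 1.008349269175"
    by (simp add: eval_nat_numeral)
  ultimately show ?thesis using V Z(2) by (intro that) (auto simp: T_def)
qed

text \<open>Half of each term is split as \<open>q p\<close> plus a correction. The
  \<open>q p\<close> sum to the weighted \<open>Q_s\<close>; the corrections are residual terms from
  17 on and six explicit values below.\<close>

lemma bhargava_beta_has_sum: "((\<lambda>p. beta_term p) has_sum bhargava_beta) {p. prime p}"
  and bhargava_beta_bounds: "1.0676432 \<le> bhargava_beta" "bhargava_beta < 1.0676433"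
proof -
  define t where "t = (\<lambda>p. beta_term p)"
  obtain Q2 Q3 Q4 Q5 Q6 Q7 where
    Q2: "((\<lambda>p. ln (real p) / (real p ^ 2 - 1)) has_sum Q2) {p. prime p}"
      "Q2 \<in> {0.5699609927 .. 0.5699609935}" and
    Q3: "((\<lambda>p. ln (real p) / (real p ^ 3 - 1)) has_sum Q3) {p. prime p}"
      "Q3 \<in> {0.1648226818 .. 0.1648226826}" and
    Q4: "((\<lambda>p. ln (real p) / (real p ^ 4 - 1)) has_sum Q4) {p. prime p}"
      "Q4 \<in> {0.0636697645 .. 0.0636697654}" and
    Q5: "((\<lambda>p. ln (real p) / (real p ^ 5 - 1)) has_sum Q5) {p. prime p}"
      "Q5 \<in> {0.0275561918 .. 0.0275561926}" and
    Q6: "((\<lambda>p. ln (real p) / (real p ^ 6 - 1)) has_sum Q6) {p. prime p}"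
      "Q6 \<in> {0.0126330687 .. 0.0126330694}" and
    Q7: "((\<lambda>p. ln (real p) / (real p ^ 7 - 1)) has_sum Q7) {p. prime p}"
      "Q7 \<in> {0.0059835582 .. 0.0059835590}"
    by (rule prime_sum_2, rule prime_sum_3, rule prime_sum_4, rule prime_sum_5, rule prime_sum_6,
        rule prime_sum_7)
  define q where "q = (\<lambda>p. ln (real p) / (real p ^ 2 - 1) + 2 * (ln (real p) / (real p ^ 3 - 1))
     + 2 * (ln (real p) / (real p ^ 4 - 1)) + 4 * (ln (real p) / (real p ^ 5 - 1))
     + 2 * (ln (real p) / (real p ^ 6 - 1)) + 6 * (ln (real p) / (real p ^ 7 - 1)))"
  have q: "(q has_sum (Q2 + 2 * Q3 + 2 * Q4 + 4 * Q5 + 2 * Q6 + 6 * Q7)) {p. prime p}"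
    unfolding q_def by (intro has_sum_add has_sum_cmult_right Q2 Q3 Q4 Q5 Q6 Q7)
  obtain V where V: "((\<lambda>p. ln (real p) * residual_weight (real p)) has_sum V) {p. prime p \<and> p \<ge> 17}"
    "V \<in> {0 .. 0.000000014}" by (rule residual_sum)
  have tp: "t p = 2 * (ln (real p) / (real p - 1)^2)" if "prime p" "p \<noteq> 2" for p
    unfolding t_def by (rule beta_term_odd[OF that])
  have "((\<lambda>p. t p / 2 - q p) has_sum V) {p. prime p \<and> p \<ge> 17}"
    by (rule iffD1[OF has_sum_cong V(1)])
       (auto simp: tp q_def residual_weight_def algebra_simps)
  moreover have "((\<lambda>p. t p / 2 - q p) has_sum (\<Sum>p\<in>{2, 3, 5, 7, 11, 13}. t p / 2 - q p))
      {p. prime p \<and> p < 17}"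
    unfolding primes_less_17 by (rule has_sum_finite) auto
  ultimately have "((\<lambda>p. t p / 2 - q p) has_sum (V + (\<Sum>p\<in>{2, 3, 5, 7, 11, 13}. t p / 2 - q p)))
      ({p. prime p \<and> p \<ge> 17} \<union> {p. prime p \<and> p < 17})"
    by (rule has_sum_Un_disjoint) auto
  also have "{p::nat. prime p \<and> p \<ge> 17} \<union> {p. prime p \<and> p < 17} = {p. prime p}" by auto
  finally have "((\<lambda>p. (t p / 2 - q p) + q p) has_sum (V + (\<Sum>p\<in>{2, 3, 5, 7, 11, 13}. t p / 2 - q p)
      + (Q2 + 2 * Q3 + 2 * Q4 + 4 * Q5 + 2 * Q6 + 6 * Q7))) {p. prime p}"
    using q by (rule has_sum_add)
  from has_sum_cmult_right[OF this, of 2]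
  have sum_t: "(t has_sum 2 * (V + (\<Sum>p\<in>{2, 3, 5, 7, 11, 13}. t p / 2 - q p)
      + (Q2 + 2 * Q3 + 2 * Q4 + 4 * Q5 + 2 * Q6 + 6 * Q7))) {p. prime p}" by simp
  hence beta: "bhargava_beta = 2 * (V + (\<Sum>p\<in>{2, 3, 5, 7, 11, 13}. t p / 2 - q p)
      + (Q2 + 2 * Q3 + 2 * Q4 + 4 * Q5 + 2 * Q6 + 6 * Q7))"
    unfolding bhargava_beta_def t_def by (rule infsumI)
  have t2: "t 2 = 0" unfolding t_def by (rule beta_term_2)
  \<comment> \<open>The prime 2 contributes \<open>- q 2\<close>: its term in \<open>\<beta>\<close>
    is 0, but the sums \<open>Q_s\<close> contain it.\<close>
  have "(\<Sum>p\<in>{2, 3, 5, 7, 11, 13}. t p / 2 - q p) \<in> {- 0.6645165233 .. - 0.6645165231}"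
    using ln_prime_bounds by (auto simp: t2 tp q_def)
  thus "1.0676432 \<le> bhargava_beta" "bhargava_beta < 1.0676433"
    unfolding beta using Q2(2) Q3(2) Q4(2) Q5(2) Q6(2) Q7(2) V(2) by auto
  have "(t has_sum bhargava_beta) {p. prime p}" unfolding beta by (rule sum_t)
  thus "((\<lambda>p. beta_term p) has_sum bhargava_beta) {p. prime p}" unfolding t_def .
qed

section \<open>The asymptotic formula\<close>

text \<open>Writing each \<open>ln m\<close> as the divisor sum of \<open>mangoldt\<close> and
  exchanging the sums counts, for each \<open>d\<close>, its multiples up to
  \<open>N\<close>.\<close>

lemma ln_fact_eq_sum_mangoldt:
  "ln (fact N) = (\<Sum>d\<in>{1..N}. mangoldt d * real (N div d))"
proof -
  have "ln (fact N) = (\<Sum>m\<in>{1..N}. ln (real m))"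
    unfolding fact_prod of_nat_prod by (rule ln_prod) auto
  also have "\<dots> = (\<Sum>m\<in>{1..N}. \<Sum>d\<in>{1..N}. if d dvd m then mangoldt d else 0)"
  proof (rule sum.cong[OF refl])
    fix m assume m: "m \<in> {1..N}"
    hence "ln (real m) = (\<Sum>d | d dvd m. mangoldt d)"
      using mangoldt_sum[of m, where ?'a = real] by auto
    also have "{d. d dvd m} = {d \<in> {1..N}. d dvd m}"
      using m by (auto intro: Nat.gr0I dest: dvd_imp_le)
    also have "(\<Sum>d\<in>{d \<in> {1..N}. d dvd m}. mangoldt d)
        = (\<Sum>d\<in>{1..N}. if d dvd m then mangoldt d else (0::real))"
      by (rule sum.inter_filter) simp
    finally show "ln (real m) = (\<Sum>d\<in>{1..N}. if d dvd m then mangoldt d else 0)" .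
  qed
  also have "\<dots> = (\<Sum>d\<in>{1..N}. \<Sum>m\<in>{1..N}. if d dvd m then mangoldt d else 0)"
    by (rule sum.swap)
  also have "\<dots> = (\<Sum>d\<in>{1..N}. mangoldt d * real (N div d))"
  proof (rule sum.cong[OF refl])
    fix d assume "d \<in> {1..N}"
    hence d: "d > 0" by simp
    have "bij_betw (\<lambda>j. d * j) {1..N div d} {m \<in> {1..N}. d dvd m}"
      by (rule bij_betwI[of _ _ _ "\<lambda>m. m div d"])
         (use d in \<open>auto simp: less_eq_div_iff_mult_less_eq mult.commute div_le_mono intro: Nat.gr0I\<close>)
    hence "card {m \<in> {1..N}. d dvd m} = N div d"
      using bij_betw_same_card by fastforce
    thus "(\<Sum>m\<in>{1..N}. if d dvd m then mangoldt d else 0) = mangoldt d * real (N div d)"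
      by (simp flip: sum.inter_filter)
  qed
  finally show ?thesis .
qed

text \<open>The free cut-offs \<open>X\<close> and \<open>K\<close> allow Legendre's formula to be
  padded with zeros to the index ranges used for the Bhargava factorial.\<close>

lemma ln_fact_legendre:
  assumes "N \<le> X" "N \<le> K"
  shows "ln (fact N) = (\<Sum>p | prime p \<and> p \<le> X. ln (real p) * (\<Sum>k<K. real (N div p ^ Suc k)))"
proof -
  define A where "A = {(p, k). prime p \<and> p ^ Suc k \<le> N}"
  have pow: "p \<le> N \<and> k < N" if "prime p" "p ^ Suc k \<le> N" for p k :: nat
  proof -
    have p2: "p \<ge> 2" using that(1) by (rule prime_ge_2_nat)
    have "p ^ 1 \<le> p ^ Suc k" using p2 by (intro power_increasing) auto
    moreover have "k < 2 ^ k" by (rule less_exp)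
    moreover have "(2::nat) ^ k \<le> p ^ k" using p2 by (intro power_mono) auto
    moreover have "p ^ k \<le> p ^ Suc k" using p2 by simp
    ultimately show ?thesis using that(2) unfolding power_one_right by linarith
  qed
  have img: "(\<lambda>(p, k). p ^ Suc k) ` A = {d \<in> {1..N}. primepow d}"
  proof (intro equalityI subsetI)
    fix d assume "d \<in> {d \<in> {1..N}. primepow d}"
    hence d: "d \<le> N" "d \<in> Collect primepow" by auto
    hence "d \<in> (\<lambda>(p, k). p ^ Suc k) ` (Collect prime \<times> UNIV)"
      using bij_betw_imp_surj_on[OF bij_betw_primepows[where ?'a = nat]] by simp
    then obtain p k where "prime p" "d = p ^ Suc k" by auto
    thus "d \<in> (\<lambda>(p, k). p ^ Suc k) ` A" using d by (auto simp: A_def image_iff)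
  qed (auto simp: A_def Suc_le_eq prime_gt_0_nat simp del: power_Suc)
  have inj: "inj_on (\<lambda>(p, k). p ^ Suc k) A"
    by (rule inj_on_subset[OF bij_betw_imp_inj_on[OF bij_betw_primepows]]) (auto simp: A_def)
  have "ln (fact N) = (\<Sum>d\<in>{1..N}. mangoldt d * real (N div d))"
    by (rule ln_fact_eq_sum_mangoldt)
  also have "\<dots> = (\<Sum>d\<in>{d \<in> {1..N}. primepow d}. mangoldt d * real (N div d))"
    by (rule sum.mono_neutral_right) (auto simp: mangoldt_def)
  also have "\<dots> = (\<Sum>(p, k)\<in>A. mangoldt (p ^ Suc k) * real (N div p ^ Suc k))"
    unfolding img[symmetric] by (subst sum.reindex[OF inj]) (simp add: case_prod_unfold o_def)
  also have "\<dots> = (\<Sum>(p, k)\<in>A. ln (real p) * real (N div p ^ Suc k))"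
    by (rule sum.cong) (auto simp: A_def mangoldt_primepow simp del: power_Suc)
  \<comment> \<open>The pairs added in the rectangle have \<open>p ^ Suc k > N\<close>, so their
    quotients are 0.\<close>
  also have "\<dots> = (\<Sum>(p, k)\<in>{p. prime p \<and> p \<le> X} \<times> {..<K}. ln (real p) * real (N div p ^ Suc k))"
  proof (rule sum.mono_neutral_left)
    show "A \<subseteq> {p. prime p \<and> p \<le> X} \<times> {..<K}"
    proof
      fix z assume "z \<in> A"
      then obtain p k where z: "z = (p, k)" "prime p" "p ^ Suc k \<le> N"
        unfolding A_def by blast
      thus "z \<in> {p. prime p \<and> p \<le> X} \<times> {..<K}" using pow[OF z(2,3)] assms by simp
    qed
  qed (auto simp: A_def div_greater_zero_iff simp del: power_Suc)
  also have "\<dots> = (\<Sum>p | prime p \<and> p \<le> X. ln (real p) * (\<Sum>k<K. real (N div p ^ Suc k)))"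
    by (simp add: sum.cartesian_product[symmetric] sum_distrib_left)
  finally show ?thesis .
qed

text \<open>
  For \<open>p = 2\<close> the exponent of the Bhargava factorial is exactly Legendre's exponent of \<open>(2n)!\<close>.
\<close>
definition floor_defect :: "nat \<Rightarrow> nat \<Rightarrow> real" where
  "floor_defect p n = (if p = 2 then 0 else
     (\<Sum>k<2 * n + 1. real (2 * n div ((p - 1) * p ^ k)) - real (2 * n div p ^ Suc k)))"

lemma bhargava_exponent_eq:
  assumes p: "prime p"
  shows "real (bhargava_exponent p (n + 1))
    = (\<Sum>k<2 * n + 1. real (2 * n div p ^ Suc k)) + floor_defect p n"
proof -
  \<comment> \<open>The cut-off \<open>2 * n + 1\<close> exceeds what the exponent needs and is
    chosen to match Legendre's sum for \<open>(2n)!\<close>.\<close>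
  have fin: "bhargava_exponent p (n + 1) = (\<Sum>k<2 * n + 1.
      nat \<lfloor>(real (n + 1) - 1) / (real_of_int \<lceil>(real p - 1) / 2\<rceil> * real p ^ k)\<rfloor>)"
    unfolding bhargava_exponent_def
    by (rule suminf_finite[OF finite_lessThan]) (rule bhargava_term_eq_0[OF p], simp)
  show ?thesis
  proof (cases "p = 2")
    case True
    have "\<lceil>(1::real) / 2\<rceil> = 1" by (simp add: ceiling_eq_iff)
    \<comment> \<open>Doubling numerator and denominator shifts \<open>k\<close> by one, which is
      why the defect at 2 is zero.\<close>
    moreover have "\<lfloor>real n / 2 ^ k\<rfloor> = int (2 * n div 2 ^ Suc k)" for k
      using floor_divide_of_nat_eq[of n "2 ^ k", where ?'a = real] by simp
    ultimately show ?thesis unfolding fin using True by (simp add: floor_defect_def)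
  next
    case False
    have p1: "p \<ge> 1" using prime_ge_1_nat[OF p] .
    have "nat \<lfloor>(real (n + 1) - 1) / (real_of_int \<lceil>(real p - 1) / 2\<rceil> * real p ^ k)\<rfloor>
        = 2 * n div ((p - 1) * p ^ k)" for k
    proof -
      have "(real (n + 1) - 1) / (real_of_int \<lceil>(real p - 1) / 2\<rceil> * real p ^ k)
          = real (2 * n) / real ((p - 1) * p ^ k)"
        unfolding half_pred_odd_prime[OF p False] using p1 by (simp add: of_nat_diff)
      thus ?thesis by (simp only: floor_divide_of_nat_eq nat_int)
    qed
    thus ?thesis unfolding fin using False by (simp add: floor_defect_def sum_subtractf)
  qed
qed

lemma ln_bhargava_factorial:
  "ln (real (bhargava_factorial (n + 1))) - ln (fact (2 * n))
     = (\<Sum>p | prime p \<and> p \<le> 2 * n + 1. ln (real p) * floor_defect p n)"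
proof -
  \<comment> \<open>The range reaches \<open>2 * n + 1\<close>: if prime, it divides the Bhargava
    factorial once when \<open>n > 0\<close>, yet it does not divide \<open>(2n)!\<close>.\<close>
  have set_eq: "{p::nat. prime p \<and> p < 2 * (n + 1)} = {p. prime p \<and> p \<le> 2 * n + 1}" by auto
  have "ln (real (bhargava_factorial (n + 1))) =
      (\<Sum>p | prime p \<and> p \<le> 2 * n + 1. ln (real p ^ bhargava_exponent p (n + 1)))"
    unfolding bhargava_factorial_finite set_eq of_nat_prod of_nat_power
    by (rule ln_prod) (auto simp: prime_gt_0_nat)
  also have "\<dots> = (\<Sum>p | prime p \<and> p \<le> 2 * n + 1. ln (real p) *
      ((\<Sum>k<2 * n + 1. real (2 * n div p ^ Suc k)) + floor_defect p n))"
    by (rule sum.cong[OF refl], subst ln_realpow, simp_all only: mem_Collect_eq bhargava_exponent_eq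
        prime_gt_0_nat of_nat_0_less_iff mult.commute)
  also have "\<dots> = ln (fact (2 * n)) + (\<Sum>p | prime p \<and> p \<le> 2 * n + 1. ln (real p) * floor_defect p n)"
    by (simp only: distrib_left sum.distrib ln_fact_legendre[of "2 * n" "2 * n + 1" "2 * n + 1"])
  finally show ?thesis by simp
qed

section \<open>Bounds and limit of the floor defect\<close>

lemma floor_defect_nonneg:
  assumes "prime p"
  shows "0 \<le> floor_defect p n"
proof -
  have p: "p \<ge> 2" using assms by (rule prime_ge_2_nat)
  have "real (2 * n div p ^ Suc k) \<le> real (2 * n div ((p - 1) * p ^ k))" for k
    using p by (intro of_nat_mono div_le_mono2) auto
  thus ?thesis by (auto simp: floor_defect_def simp del: sum.lessThan_Suc power_Suc intro!: sum_nonneg)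
qed

text \<open>The \<open>k = 0\<close> term keeps its floors, since these telescope over consecutive
  integers. For \<open>k \<ge> 1\<close> the subtracted floors are dropped and the rest is a
  geometric series; times \<open>ln p\<close>, it becomes \<open>n\<close> times the term of
  \<open>\<beta>\<close> for odd \<open>p\<close>.\<close>

lemma floor_defect_le:
  assumes p: "prime p"
  shows "floor_defect p n \<le> (real (2 * n div (p - 1)) - real (2 * n div p)) + 2 * real n / (real p - 1)^2"
proof (cases "p = 2")
  case True
  have "real (2 * n div 2) \<le> real (2 * n)" by simp
  thus ?thesis using True by (simp add: floor_defect_def)
next
  case False
  have p2: "p \<ge> 2" using p by (rule prime_ge_2_nat)
  define x where "x = 1 / real p"
  have x: "0 < x" "x < 1" using p2 by (auto simp: x_def)
  have "floor_defect p n = (real (2 * n div (p - 1)) - real (2 * n div p)) +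
      (\<Sum>k<2 * n. real (2 * n div ((p - 1) * p ^ Suc k)) - real (2 * n div p ^ Suc (Suc k)))"
    using False by (simp add: floor_defect_def sum.lessThan_Suc_shift del: sum.lessThan_Suc power_Suc)
  also have "(\<Sum>k<2 * n. real (2 * n div ((p - 1) * p ^ Suc k)) - real (2 * n div p ^ Suc (Suc k)))
      \<le> (\<Sum>k<2 * n. 2 * real n / (real p - 1) * x * x ^ k)"
  proof (rule sum_mono)
    fix k
    have "real (2 * n div ((p - 1) * p ^ Suc k)) \<le> real (2 * n) / real ((p - 1) * p ^ Suc k)"
      by (rule of_nat_div_le_of_nat)
    also have "\<dots> = 2 * real n / (real p - 1) * x * x ^ k"
      using p2 by (simp add: x_def of_nat_diff power_divide)
    finally show "real (2 * n div ((p - 1) * p ^ Suc k)) - real (2 * n div p ^ Suc (Suc k))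
        \<le> 2 * real n / (real p - 1) * x * x ^ k" by simp
  qed
  also have "\<dots> = 2 * real n / (real p - 1) * x * (\<Sum>k<2 * n. x ^ k)"
    by (simp add: sum_distrib_left)
  also have "\<dots> \<le> 2 * real n / (real p - 1) * x * (1 / (1 - x))"
    using x p2 by (intro mult_left_mono) (auto simp: sum_gp_strict intro!: divide_right_mono)
  also have "x * (1 / (1 - x)) = 1 / (real p - 1)" using p2 by (simp add: x_def field_simps)
  hence "2 * real n / (real p - 1) * x * (1 / (1 - x)) = 2 * real n / (real p - 1)^2"
    by (simp only: mult.assoc) (simp add: power2_eq_square)
  finally show ?thesis by simp
qed

text \<open>
  Summing over all integers instead of over primes makes the floors telescope; this is what gives a
  bound of order \<open>N * ln M / M\<close> without any information on the distribution of primes.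
\<close>
lemma abel_sum_floor_differences:
  assumes M: "M \<ge> 1" and X: "M \<le> X"
  shows "(\<Sum>m\<in>{M<..X}. ln (real m) * (real (N div (m - 1)) - real (N div m)))
    + ln (real (X + 1)) * real (N div X) \<le> real N * ((ln (real (M + 1)) + 1) / real M - 1 / real X)"
  using X
proof (induction X rule: dec_induct)
  case base
  have "ln (real (M + 1)) * real (N div M) \<le> ln (real (M + 1)) * (real N / real M)"
    by (intro mult_left_mono of_nat_div_le_of_nat) auto
  thus ?case using M by (simp add: field_simps)
next
  case (step X)
  have X1: "X \<ge> 1" using M step by simp
  have "{M<..Suc X} = insert (Suc X) {M<..X}" using step by auto
  hence split: "(\<Sum>m\<in>{M<..Suc X}. ln (real m) * (real (N div (m - 1)) - real (N div m)))
      = ln (real (Suc X)) * (real (N div X) - real (N div Suc X))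
        + (\<Sum>m\<in>{M<..X}. ln (real m) * (real (N div (m - 1)) - real (N div m)))" by simp
  \<comment> \<open>Passing from \<open>X\<close> to \<open>X + 1\<close> changes the left side by
    this increment times \<open>N div (X + 1)\<close>. It is at most
    \<open>N / (X * (X + 1))\<close>, the change of \<open>- N / X\<close> on the right.\<close>
  have "ln (real (X + 2)) - ln (real (X + 1)) = ln (1 + 1 / real (X + 1))"
    using ln_div[of "real (X + 2)" "real (X + 1)"] by (simp add: field_simps)
  also have "\<dots> \<le> 1 / real (X + 1)" by (rule ln_add_one_self_le_self) simp
  finally have "(ln (real (X + 2)) - ln (real (X + 1))) * real (N div Suc X)
      \<le> 1 / real (X + 1) * (real N / real (Suc X))"
    by (intro mult_mono of_nat_div_le_of_nat) auto
  also have "\<dots> \<le> 1 / real X * (real N / real (Suc X))"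
    using X1 by (intro mult_right_mono) (auto simp: field_simps)
  also have "\<dots> = real N * (1 / real X - 1 / real (Suc X))" using X1 by (simp add: field_simps)
  finally show ?case using step.IH unfolding split by (simp add: algebra_simps)
qed

text \<open>Divided by \<open>n\<close>, the \<open>k\<close>-th term converges and is dominated by
  a geometric term independent of \<open>n\<close>, so Tannery's theorem allows the limit inside the
  sum.\<close>

lemma floor_defect_tendsto:
  assumes p: "prime p" "p \<noteq> 2"
  shows "(\<lambda>n. floor_defect p n / real n) \<longlonglongrightarrow> 2 / (real p - 1)^2"
proof -
  have p2: "p \<ge> 2" using p(1) by (rule prime_ge_2_nat)
  define a where "a = (\<lambda>k n. (real (2 * n div ((p - 1) * p ^ k)) - real (2 * n div p ^ Suc k)) / real n)"
  define b where "b = (\<lambda>k. 2 / ((real p - 1) * real p ^ k) - 2 / real p ^ Suc k)"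
  define x where "x = 1 / real p"
  have x: "0 < x" "x < 1" "x / (1 - x) = 1 / (real p - 1)"
    using p2 by (auto simp: x_def field_simps)
  have lim_div: "(\<lambda>n. real (2 * n div m) / real n) \<longlonglongrightarrow> 2 / real m" if "m > 0" for m
  proof -
    have "(\<lambda>n::nat. real_of_int \<lfloor>2 * real n / real m\<rfloor> / real n) \<longlonglongrightarrow> 2 / real m"
      using that by (real_asymp simp: field_simps)
    moreover have "real_of_int \<lfloor>2 * real n / real m\<rfloor> = real (2 * n div m)" for n
      using floor_divide_of_nat_eq[of "2 * n" m, where ?'a = real] by simp
    ultimately show ?thesis by simp
  qed
  have lim_a: "(\<lambda>n. a k n) \<longlonglongrightarrow> b k" for k
  proof -
    have "(\<lambda>n. real (2 * n div ((p - 1) * p ^ k)) / real n - real (2 * n div p ^ Suc k) / real n)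
        \<longlonglongrightarrow> 2 / real ((p - 1) * p ^ k) - 2 / real (p ^ Suc k)"
      by (intro tendsto_diff lim_div) (use p2 in auto)
    thus ?thesis using p2 by (simp add: a_def b_def diff_divide_distrib of_nat_diff)
  qed
  have "norm (a k n) \<le> 2 / (real p - 1) * x ^ k" for k n
  proof (cases "n = 0")
    case False
    have le: "real (2 * n div p ^ Suc k) \<le> real (2 * n div ((p - 1) * p ^ k))"
      using p2 by (intro of_nat_mono div_le_mono2) auto
    have "norm (a k n) = a k n" using le by (simp add: a_def)
    also have "\<dots> \<le> real (2 * n div ((p - 1) * p ^ k)) / real n"
      unfolding a_def by (intro divide_right_mono) auto
    also have "\<dots> \<le> real (2 * n) / real ((p - 1) * p ^ k) / real n"
      by (intro divide_right_mono of_nat_div_le_of_nat) auto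
    also have "\<dots> = 2 / (real p - 1) * x ^ k"
      using False p2 by (simp add: x_def of_nat_diff power_divide)
    finally show ?thesis .
  qed (use p2 x in \<open>auto simp: a_def\<close>)
  hence bound: "eventually (\<lambda>(k, n). norm (a k n) \<le> 2 / (real p - 1) * x ^ k) (at_top \<times>\<^sub>F sequentially)"
    by (intro always_eventually) auto
  have "summable (\<lambda>k. 2 / (real p - 1) * x ^ k)"
    using x by (intro summable_mult summable_geometric) auto
  hence lim: "(\<lambda>n. \<Sum>k. a k n) \<longlonglongrightarrow> (\<Sum>k. b k)"
    using tannerys_theorem[OF lim_a bound] by simp
  have "(\<lambda>k. 2 / (real p - 1) * x * x ^ k) sums (2 / (real p - 1) * x * (1 / (1 - x)))"
    using x by (intro sums_mult geometric_sums) auto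
  moreover have "(\<lambda>k. 2 / (real p - 1) * x * x ^ k) = b"
    using p2 by (auto simp: b_def x_def power_divide field_simps fun_eq_iff)
  moreover have "2 / (real p - 1) * x * (1 / (1 - x)) = 2 / (real p - 1)^2"
  proof -
    have "2 / (real p - 1) * x * (1 / (1 - x)) = 2 / (real p - 1) * (x / (1 - x))" by simp
    thus ?thesis unfolding x(3) by (simp add: power2_eq_square)
  qed
  ultimately have suminf_b: "(\<Sum>k. b k) = 2 / (real p - 1)^2" by (simp add: sums_iff)
  have "(\<Sum>k. a k n) = floor_defect p n / real n" for n
  proof -
    \<comment> \<open>Beyond the cut-off \<open>p^k\<close> exceeds \<open>2 * n\<close>, so both
      quotients vanish.\<close>
    have "(\<Sum>k. a k n) = (\<Sum>k<2 * n + 1. a k n)"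
    proof (rule suminf_finite[OF finite_lessThan])
      fix k assume "k \<notin> {..<2 * n + 1}"
      hence k: "2 * n < k" by simp
      also have "k < 2 ^ k" by (rule less_exp)
      also have "(2::nat) ^ k \<le> p ^ k" using p2 by (intro power_mono) auto
      finally have "2 * n < p ^ k" .
      moreover have "p ^ k \<le> (p - 1) * p ^ k" "p ^ k \<le> p ^ Suc k" using p2 by auto
      ultimately have "2 * n < (p - 1) * p ^ k" "2 * n < p ^ Suc k" by linarith+
      thus "a k n = 0" unfolding a_def by (simp only: div_less) simp
    qed
    thus ?thesis using p(2) by (simp add: a_def floor_defect_def sum_divide_distrib
        del: sum.lessThan_Suc power_Suc)
  qed
  thus ?thesis using lim suminf_b by simp
qed

section \<open>Passage from the partial sums to \<open>\<beta>\<close>\<close>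

lemma beta_term_nonneg:
  assumes "prime p"
  shows "0 \<le> beta_term p"
proof (cases "p = 2")
  case False
  thus ?thesis
    unfolding beta_term_odd[OF assms False] using prime_ge_1_nat[OF assms] by simp
qed (use beta_term_2 in simp)

lemma beta_partial_sums_le: "(\<Sum>p | prime p \<and> p \<le> M. beta_term p) \<le> bhargava_beta"
  by (rule finite_sum_le_has_sum[OF bhargava_beta_has_sum]) (use beta_term_nonneg in auto)

lemma beta_partial_sums_tendsto:
  "(\<lambda>M. \<Sum>p | prime p \<and> p \<le> M. beta_term p) \<longlonglongrightarrow> bhargava_beta"
proof -
  have "((\<lambda>p. if prime p then beta_term p else 0) has_sum bhargava_beta) UNIV
      \<longleftrightarrow> (beta_term has_sum bhargava_beta) {p. prime p}"
    by (rule has_sum_cong_neutral) auto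
  hence "(\<lambda>p. if prime p then beta_term p else 0) sums bhargava_beta"
    using bhargava_beta_has_sum by (intro has_sum_imp_sums) simp
  moreover have "(\<Sum>p\<le>M. if prime p then beta_term p else 0)
      = (\<Sum>p | prime p \<and> p \<le> M. beta_term p)" for M
  proof -
    have "(\<Sum>p\<le>M. if prime p then beta_term p else 0) = (\<Sum>p\<in>{p \<in> {..M}. prime p}. beta_term p)"
      by (rule sum.inter_filter[symmetric]) simp
    also have "{p \<in> {..M}. prime p} = {p. prime p \<and> p \<le> M}" by auto
    finally show ?thesis .
  qed
  ultimately show ?thesis by (simp add: sums_def_le)
qed

lemma floor_defect_tendsto_beta_term:
  assumes "prime p"
  shows "(\<lambda>n. ln (real p) * floor_defect p n / real n) \<longlonglongrightarrow> beta_term p"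
proof (cases "p = 2")
  case True
  thus ?thesis using beta_term_2 by (simp add: floor_defect_def)
next
  case False
  have "(\<lambda>n. ln (real p) * (floor_defect p n / real n)) \<longlonglongrightarrow> ln (real p) * (2 / (real p - 1)^2)"
    by (intro tendsto_mult_left floor_defect_tendsto assms False)
  thus ?thesis unfolding beta_term_odd[OF assms False] by (simp add: mult.commute)
qed

text \<open>The \<open>k = 0\<close> parts are extended to all integers beyond \<open>M\<close> and
  summed by parts; the remaining parts are bounded by \<open>n\<close> times a tail of
  \<open>\<beta>\<close>.\<close>

lemma floor_defect_large_primes:
  assumes M: "2 \<le> M" "M \<le> 2 * n + 1"
  shows "(\<Sum>p | prime p \<and> M < p \<and> p \<le> 2 * n + 1. ln (real p) * floor_defect p n)
    \<le> real n * (2 * (ln (real M + 1) + 1) / real M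
        + (bhargava_beta - (\<Sum>p | prime p \<and> p \<le> M. beta_term p)))"
proof -
  define A where "A = {p. prime p \<and> M < p \<and> p \<le> 2 * n + 1}"
  define jump where "jump = (\<lambda>m. ln (real m) * (real (2 * n div (m - 1)) - real (2 * n div m)))"
  have fin: "finite A" by (rule finite_subset[of _ "{..2 * n + 1}"]) (auto simp: A_def)
  have "(\<Sum>p\<in>A. ln (real p) * floor_defect p n) \<le> (\<Sum>p\<in>A. jump p + real n * beta_term p)"
  proof (rule sum_mono)
    fix p assume "p \<in> A"
    hence p: "prime p" "p \<noteq> 2" "p \<ge> 1" using M(1) by (auto simp: A_def)
    have "ln (real p) * floor_defect p n \<le> ln (real p) *
        ((real (2 * n div (p - 1)) - real (2 * n div p)) + 2 * real n / (real p - 1)^2)"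
      using p by (intro mult_left_mono floor_defect_le) auto
    also have "\<dots> = jump p + real n * beta_term p"
      unfolding beta_term_odd[OF p(1,2)] jump_def by (simp add: algebra_simps)
    finally show "ln (real p) * floor_defect p n \<le> jump p + real n * beta_term p" .
  qed
  also have "\<dots> = (\<Sum>p\<in>A. jump p) + real n * (\<Sum>p\<in>A. beta_term p)"
    by (simp only: sum.distrib sum_distrib_left)
  also have "\<dots> \<le> real (2 * n) * ((ln (real (M + 1)) + 1) / real M)
      + real n * (bhargava_beta - (\<Sum>p | prime p \<and> p \<le> M. beta_term p))"
  proof (intro add_mono mult_left_mono)
    have "(\<Sum>p\<in>A. jump p) \<le> (\<Sum>m\<in>{M<..2 * n + 1}. jump m)"
    proof (rule sum_mono2)
      fix m assume "m \<in> {M<..2 * n + 1} - A"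
      hence "m \<ge> 2" using M(1) by auto
      thus "0 \<le> jump m" unfolding jump_def
        by (intro mult_nonneg_nonneg) (auto intro!: div_le_mono2)
    qed (auto simp: A_def)
    also have "\<dots> \<le> real (2 * n) * ((ln (real (M + 1)) + 1) / real M)"
    proof -
      \<comment> \<open>At the end point \<open>2 * n + 1\<close> the quotient is 0, so the boundary
        term disappears.\<close>
      have "(\<Sum>m\<in>{M<..2 * n + 1}. jump m) + ln (real (2 * n + 1 + 1)) * real (2 * n div (2 * n + 1))
          \<le> real (2 * n) * ((ln (real (M + 1)) + 1) / real M - 1 / real (2 * n + 1))"
        unfolding jump_def by (rule abel_sum_floor_differences) (use M in auto)
      moreover have "2 * n div (2 * n + 1) = 0" by simp
      moreover have "0 \<le> real (2 * n) * (1 / real (2 * n + 1))" by simp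
      ultimately show ?thesis by (simp only: right_diff_distrib)
    qed
    finally show "(\<Sum>p\<in>A. jump p) \<le> real (2 * n) * ((ln (real (M + 1)) + 1) / real M)" .
    show "(\<Sum>p\<in>A. beta_term p) \<le> bhargava_beta - (\<Sum>p | prime p \<and> p \<le> M. beta_term p)"
    proof -
      have "{p. prime p \<and> p \<le> 2 * n + 1} = A \<union> {p. prime p \<and> p \<le> M}" using M by (auto simp: A_def)
      hence "(\<Sum>p | prime p \<and> p \<le> 2 * n + 1. beta_term p)
          = (\<Sum>p\<in>A. beta_term p) + (\<Sum>p | prime p \<and> p \<le> M. beta_term p)"
        using fin by (simp only:) (rule sum.union_disjoint, auto simp: A_def)
      thus ?thesis using beta_partial_sums_le[of "2 * n + 1"] by linarith
    qed
  qed simp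
  also have "\<dots> = real n * (2 * (ln (real M + 1) + 1) / real M
        + (bhargava_beta - (\<Sum>p | prime p \<and> p \<le> M. beta_term p)))"
    by (simp only: distrib_left) (simp add: add.commute)
  finally show ?thesis unfolding A_def .
qed

text \<open>\<open>M\<close> is fixed first, making both contributions beyond \<open>M\<close> small
  uniformly in \<open>n\<close>; the finitely many primes up to \<open>M\<close> then converge
  termwise.\<close>

lemma sum_floor_defect_asymptotics:
  "(\<lambda>n. (\<Sum>p | prime p \<and> p \<le> 2 * n + 1. ln (real p) * floor_defect p n) - bhargava_beta * real n)
     \<in> o(\<lambda>n. real n)"
proof (rule landau_o.smallI)
  fix c :: real assume c: "c > 0"
  define S where "S = (\<lambda>M. \<Sum>p | prime p \<and> p \<le> M. beta_term p)"
  have "(\<lambda>M. 2 * (ln (real M + 1) + 1) / real M) \<longlonglongrightarrow> 0" by real_asymp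
  hence "eventually (\<lambda>M. 2 * (ln (real M + 1) + 1) / real M < c / 4) sequentially"
    using c by (intro order_tendstoD) auto
  moreover have "eventually (\<lambda>M. S M > bhargava_beta - c / 4) sequentially"
    using beta_partial_sums_tendsto c unfolding S_def by (intro order_tendstoD) auto
  ultimately have "eventually (\<lambda>M. 2 * (ln (real M + 1) + 1) / real M < c / 4
      \<and> S M > bhargava_beta - c / 4 \<and> M \<ge> 2) sequentially"
    using eventually_ge_at_top[of 2] by eventually_elim auto
  then obtain M where M: "2 * (ln (real M + 1) + 1) / real M < c / 4"
      "S M > bhargava_beta - c / 4" "M \<ge> 2"
    by (auto dest: eventually_happens)
  have "(\<lambda>n. \<Sum>p | prime p \<and> p \<le> M. ln (real p) * floor_defect p n / real n) \<longlonglongrightarrow> S M"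
    unfolding S_def by (intro tendsto_sum floor_defect_tendsto_beta_term) auto
  from tendstoD[OF this, of "c / 4"] c
  have "eventually (\<lambda>n. dist (\<Sum>p | prime p \<and> p \<le> M. ln (real p) * floor_defect p n / real n) (S M)
      < c / 4) sequentially" by simp
  moreover have "eventually (\<lambda>n. n \<ge> M) sequentially" by (rule eventually_ge_at_top)
  ultimately show "eventually (\<lambda>n. norm ((\<Sum>p | prime p \<and> p \<le> 2 * n + 1.
      ln (real p) * floor_defect p n) - bhargava_beta * real n) \<le> c * norm (real n)) sequentially"
  proof eventually_elim
    case (elim n)
    define small where "small = (\<Sum>p | prime p \<and> p \<le> M. ln (real p) * floor_defect p n)"
    define large where "large = (\<Sum>p | prime p \<and> M < p \<and> p \<le> 2 * n + 1. ln (real p) * floor_defect p n)"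
    have n: "real n > 0" using elim M(3) by simp
    have "{p::nat. prime p \<and> p \<le> 2 * n + 1}
        = {p. prime p \<and> p \<le> M} \<union> {p. prime p \<and> M < p \<and> p \<le> 2 * n + 1}"
      using elim by auto
    hence split: "(\<Sum>p | prime p \<and> p \<le> 2 * n + 1. ln (real p) * floor_defect p n) = small + large"
      unfolding small_def large_def by (simp only:) (rule sum.union_disjoint, auto)
    have "\<bar>small / real n - S M\<bar> < c / 4"
      using elim(1) by (simp add: small_def dist_real_def sum_divide_distrib)
    hence "\<bar>small / real n - S M\<bar> * real n < c / 4 * real n"
      using n by (rule mult_strict_right_mono)
    moreover have "\<bar>small / real n - S M\<bar> * real n = \<bar>small - S M * real n\<bar>"
    proof -
      have "\<bar>small / real n - S M\<bar> * real n = \<bar>(small / real n - S M) * real n\<bar>"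
        by (simp add: abs_mult)
      also have "(small / real n - S M) * real n = small - S M * real n"
        using n by (simp add: field_simps)
      finally show ?thesis .
    qed
    ultimately have s: "\<bar>small - S M * real n\<bar> < c / 4 * real n" by simp
    have "large \<le> real n * (2 * (ln (real M + 1) + 1) / real M + (bhargava_beta - S M))"
      unfolding large_def S_def by (rule floor_defect_large_primes) (use M elim in auto)
    also have "\<dots> \<le> real n * (c / 4 + c / 4)"
      using M(2) n by (intro mult_left_mono add_mono less_imp_le[OF M(1)]) auto
    finally have l: "large \<le> c / 2 * real n" by (simp add: algebra_simps)
    have l0: "0 \<le> large" unfolding large_def
      by (intro sum_nonneg mult_nonneg_nonneg floor_defect_nonneg) (auto simp: Suc_le_eq prime_gt_0_nat)
    have "S M * real n \<le> bhargava_beta * real n"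
      using beta_partial_sums_le[of M] n by (intro mult_right_mono) (auto simp: S_def)
    moreover have "bhargava_beta * real n \<le> (S M + c / 4) * real n"
      using M n by (intro mult_right_mono) auto
    \<comment> \<open>Upward the error is at most \<open>c / 4 + c / 2\<close>, since
      \<open>S M\<close> does not exceed \<open>\<beta>\<close>; downward at most
      \<open>c / 4 + c / 4\<close>, since \<open>large\<close> is nonnegative.\<close>
    ultimately show ?case
      unfolding split real_norm_def abs_of_nat using s l l0 unfolding distrib_right by linarith
  qed
qed

theorem theorem3:
  shows "(\<lambda>n::nat. ln (real (bhargava_factorial (n + 1)))
            - (ln (fact (2 * n) :: real) + bhargava_beta * real n)) \<in> o(\<lambda>n. real n)
       \<and> 1.0676432 \<le> bhargava_beta \<and> bhargava_beta < 1.0676433"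
proof (intro conjI bhargava_beta_bounds)
  have "(\<lambda>n::nat. ln (real (bhargava_factorial (n + 1)))
            - (ln (fact (2 * n) :: real) + bhargava_beta * real n))
      = (\<lambda>n. (\<Sum>p | prime p \<and> p \<le> 2 * n + 1. ln (real p) * floor_defect p n)
            - bhargava_beta * real n)"
    by (simp only: ln_bhargava_factorial[symmetric] diff_diff_eq)
  thus "(\<lambda>n::nat. ln (real (bhargava_factorial (n + 1)))
            - (ln (fact (2 * n) :: real) + bhargava_beta * real n)) \<in> o(\<lambda>n. real n)"
    using sum_floor_defect_asymptotics by simp
qed

end
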